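(* Let $m\ge2$ be a fixed integer and $\gamma\in(0,1)$ a fixed reciprocal of a positive integer. For each prime $p$ such that $\gamma(p-1)$ is an integer, let $G=\mathbb{F}_{p^m}$, let $H\le\mathbb{F}_{p^{m+1}}^\times$ be the unique cyclic subgroup of order $\gamma(p^{m+1}-1)$, let $\mathbb{F}$ be a finite field of characteristic $p$ containing both $G$ and $H$, and regard $G$ and $H$ as groups of translations and scalings in $\mathrm{AGL}(1,\mathbb{F})$. Let $T$ be the normalized bi-adjacency operator of the coset graph $\mathsf{B}(G,H)$. Then, as $p\to\infty$ through such primes, $$\sigma_2(T)\ \le\ \sqrt{\frac1p+\frac{1+o(1)}{\gamma\,p^{(m+1)/2}}}\;=\;\frac{1+o(1)}{\sqrt p}.$$
   Context: $\mathrm{AGL}(1,\mathbb{F})=\{x\mapsto ax+b: a\in\mathbb{F}^\times,b\in\mathbb{F}\}$. The additive subgroup $G\le(\mathbb{F},+)$ is identified with $\{x\mapsto x+a:a\in G\}$ and the multiplicative subgroup $H\le\mathbb{F}^\times$ with $\{x\mapsto hx:h\in H\}$; $A=\langle G,H\rangle\le\mathrm{AGL}(1,\mathbb{F})$ is the group they generate. $A/G$ and $A/H$ denote the sets of right cosets $\{G\phi:\phi\in A\}$ and $\{H\phi:\phi\in A\}$. The bipartite coset graph $\mathsf{B}(G,H)$ has left vertex set $A/G$, right vertex set $A/H$, and one edge for each $\phi\in A$, joining $G\phi$ and $H\phi$. Its bi-adjacency matrix $\mathsf{B}$ has $(G\phi,H\psi)$ entry $|G\phi\cap H\psi|$. The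 normalized operator is $T=\frac{1}{\sqrt{|G||H|}}\mathsf{B}:\ell_2(A/H)\to\ell_2(A/G)$. Its largest singular value is $1$, attained on the constant function $\mathbf{1}$, and $\sigma_2(T)=\sup\{\|Tf\|: f\in\ell_2(A/H),\ f\perp\mathbf{1},\ \|f\|=1\}$. Here $o(1)$ denotes quantities tending to $0$ as $p\to\infty$ with $m,\gamma$ fixed. *)

theory Defs
  imports
    "HOL-Analysis.L2_Norm"
    "HOL-Algebra.Algebra"
    "HOL-Computational_Algebra.Primes"
begin

section \<open>The one-dimensional affine group over a field\<close>

text \<open>The product is composition of maps, so that the right coset of \<open>G\<close> by \<open>\<phi>\<close> consists of
  the maps \<open>g \<circ> \<phi>\<close> with \<open>g\<close> in \<open>G\<close>. As everywhere in \<^const>\<open>BijGroup\<close>, maps are extensional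
  functions on the carrier.\<close>

definition AGL1 :: "('a, 'r) ring_scheme \<Rightarrow> ('a \<Rightarrow> 'a) monoid" where
  "AGL1 F = (BijGroup (carrier F))
     \<lparr>carrier := {\<lambda>x\<in>carrier F. (a \<otimes>\<^bsub>F\<^esub> x) \<oplus>\<^bsub>F\<^esub> b | a b. a \<in> carrier (Multiplicative_Group.mult_of F) \<and> b \<in> carrier F}\<rparr>"

definition translation_maps :: "('a, 'r) ring_scheme \<Rightarrow> 'a set \<Rightarrow> ('a \<Rightarrow> 'a) set" where
  "translation_maps F G = (\<lambda>a. \<lambda>x\<in>carrier F. x \<oplus>\<^bsub>F\<^esub> a) ` G"

definition scaling_maps :: "('a, 'r) ring_scheme \<Rightarrow> 'a set \<Rightarrow> ('a \<Rightarrow> 'a) set" where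
  "scaling_maps F H = (\<lambda>h. \<lambda>x\<in>carrier F. h \<otimes>\<^bsub>F\<^esub> x) ` H"

definition ring_characteristic :: "('a, 'r) ring_scheme \<Rightarrow> nat" where
  "ring_characteristic R = group.ord (add_monoid R) \<one>\<^bsub>R\<^esub>"


section \<open>Bipartite coset graphs\<close>

text \<open>Parallel edges are allowed: edges are labels with a left and a right endpoint.\<close>

record ('l, 'r, 'e) bipartite_multigraph =
  lverts :: "'l set"
  rverts :: "'r set"
  edges :: "'e set"
  lend :: "'e \<Rightarrow> 'l"
  rend :: "'e \<Rightarrow> 'r"

definition biadj :: "('l, 'r, 'e) bipartite_multigraph \<Rightarrow> 'l \<Rightarrow> 'r \<Rightarrow> nat" where
  "biadj B x y = card {e \<in> edges B. lend B e = x \<and> rend B e = y}"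

definition coset_graph ::
    "('g, 'm) monoid_scheme \<Rightarrow> 'g set \<Rightarrow> 'g set \<Rightarrow> ('g set, 'g set, 'g) bipartite_multigraph" where
  "coset_graph \<Gamma> G H = (let A = subgroup_generated \<Gamma> (G \<union> H) in
     \<lparr>lverts = rcosets\<^bsub>A\<^esub> G, rverts = rcosets\<^bsub>A\<^esub> H, edges = carrier A,
      lend = (\<lambda>\<phi>. G #>\<^bsub>A\<^esub> \<phi>), rend = (\<lambda>\<phi>. H #>\<^bsub>A\<^esub> \<phi>)\<rparr>)"

lemma biadj_coset_graph:
  assumes "Group.group \<Gamma>" and G: "subgroup G \<Gamma>" and H: "subgroup H \<Gamma>"
    and L: "L \<in> lverts (coset_graph \<Gamma> G H)" and R: "R \<in> rverts (coset_graph \<Gamma> G H)"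
  shows "biadj (coset_graph \<Gamma> G H) L R = card (L \<inter> R)"
proof -
  define A where "A = subgroup_generated \<Gamma> (G \<union> H)"
  interpret \<Gamma>: Group.group \<Gamma> by fact
  interpret A: Group.group A
    unfolding A_def by (rule \<Gamma>.group_subgroup_generated)
  have sub: "subgroup K A" if "subgroup K \<Gamma>" "K \<subseteq> G \<union> H" for K
    using that by (simp add: A_def \<Gamma>.subgroup_of_subgroup_generated)
  have key: "(K #>\<^bsub>A\<^esub> \<phi> = Z) = (\<phi> \<in> Z)"
    if K: "subgroup K A" and Z: "Z \<in> rcosets\<^bsub>A\<^esub> K" and \<phi>: "\<phi> \<in> carrier A" for K Z \<phi>
  proof -
    obtain \<psi> where \<psi>: "\<psi> \<in> carrier A" "Z = K #>\<^bsub>A\<^esub> \<psi>"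
      using Z unfolding RCOSETS_def by blast
    show ?thesis
      unfolding \<psi>(2) using A.rcos_self[OF \<phi> K] A.repr_independence[OF _ \<psi>(1) K, of \<phi>] by blast
  qed
  have "L \<in> rcosets\<^bsub>A\<^esub> G" "R \<in> rcosets\<^bsub>A\<^esub> H"
    using L R by (simp_all add: coset_graph_def Let_def A_def)
  moreover have "subgroup G A" "subgroup H A"
    using sub G H by simp_all
  moreover have "L \<subseteq> carrier A"
    using subgroup.rcosets_carrier A.group_axioms calculation by blast
  ultimately have "{\<phi> \<in> carrier A. G #>\<^bsub>A\<^esub> \<phi> = L \<and> H #>\<^bsub>A\<^esub> \<phi> = R} = L \<inter> R"
    using key by blast
  then show ?thesis
    by (simp add: biadj_def coset_graph_def Let_def A_def)
qed


section \<open>The normalized operator and its second singular value\<close>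

text \<open>An element of \<open>\<ell>\<^sub>2(S)\<close> is a complex-valued function of which only the values on the finite
  set \<open>S\<close> matter; each point of \<open>S\<close> has mass one.\<close>

definition l2_inner :: "'x set \<Rightarrow> ('x \<Rightarrow> complex) \<Rightarrow> ('x \<Rightarrow> complex) \<Rightarrow> complex" where
  "l2_inner S f g = (\<Sum>x\<in>S. f x * cnj (g x))"

definition l2_norm :: "'x set \<Rightarrow> ('x \<Rightarrow> complex) \<Rightarrow> real" where
  "l2_norm S f = L2_set (\<lambda>x. cmod (f x)) S"

definition coset_operator ::
    "('g, 'm) monoid_scheme \<Rightarrow> 'g set \<Rightarrow> 'g set \<Rightarrow> ('g set \<Rightarrow> complex) \<Rightarrow> 'g set \<Rightarrow> complex" where
  "coset_operator \<Gamma> G H f L = complex_of_real (1 / sqrt (real (card G) * real (card H))) *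
     (\<Sum>R\<in>rverts (coset_graph \<Gamma> G H). of_nat (biadj (coset_graph \<Gamma> G H) L R) * f R)"

definition sigma2 :: "('g, 'm) monoid_scheme \<Rightarrow> 'g set \<Rightarrow> 'g set \<Rightarrow> real" where
  "sigma2 \<Gamma> G H = Sup {l2_norm (lverts (coset_graph \<Gamma> G H)) (coset_operator \<Gamma> G H f) | f.
     l2_inner (rverts (coset_graph \<Gamma> G H)) f (\<lambda>_. 1) = 0 \<and>
     l2_norm (rverts (coset_graph \<Gamma> G H)) f = 1}"

end

theory Submission
  imports Defs
begin

text \<open>Let \<open>V\<close> be the group of translations in \<open>A\<close>. Every element of \<open>A\<close> is a scaling by some
  \<open>h\<close> in \<open>H\<close> after a translation by some \<open>c\<close> in \<open>V\<close>, so functions on \<open>A/H\<close> are functions on \<open>V\<close>,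
  and \<open>\<parallel>Tf\<parallel>\<^sup>2\<close> is the average over \<open>h\<close> of the squared norms of the projections of \<open>f\<close> to the
  functions invariant under \<open>hG\<close>. In the Fourier basis this gives the weight
  \<open>|{h \<in> H. \<chi> is trivial on hG}| / |H|\<close> to the character \<open>\<chi>\<close>. If \<open>\<chi>\<close> is nontrivial on \<open>V\<close>, it is
  nontrivial on \<open>Hg\<close> for some \<open>g\<close> in \<open>G\<close>, and the weight is at most the proportion of \<open>h\<close> in \<open>H\<close>
  in the kernel of the nontrivial character \<open>x \<mapsto> \<chi>(xg)\<close> of the field with \<open>q = p\<^sup>m\<^sup>+\<^sup>1\<close> elements.
  Expanding the indicator of that kernel in powers of the character and bounding the Gauss periods
  by \<open>\<surd>q\<close> gives at most \<open>1/p + \<surd>q/|H|\<close>, and \<open>|H| = \<gamma>(q - 1)\<close>.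

  All Fourier analysis takes place on the additive group of the whole field, where \<open>\<psi>(ux)\<close> for one
  nontrivial character \<open>\<psi>\<close> runs through all characters; functions on \<open>V\<close> are extended by zero.\<close>

section \<open>Additive characters of finite fields\<close>

text \<open>Values off the carrier are unconstrained and only the addition of the record enters, so
  the property survives restriction of the carrier. The trivial character is included; nontriviality
  is recorded separately by a point \<open>z\<close> with
  \<open>\<psi> z \<noteq> 1\<close>.\<close>

definition additive_character :: "('a, 'r) ring_scheme \<Rightarrow> ('a \<Rightarrow> complex) \<Rightarrow> bool" where
  "additive_character R \<psi> \<longleftrightarrow> (\<forall>x\<in>carrier R. cmod (\<psi> x) = 1) \<and>
     (\<forall>x\<in>carrier R. \<forall>y\<in>carrier R. \<psi> (x \<oplus>\<^bsub>R\<^esub> y) = \<psi> x * \<psi> y)"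

lemma additive_character_norm:
  "additive_character R \<psi> \<Longrightarrow> x \<in> carrier R \<Longrightarrow> cmod (\<psi> x) = 1"
  by (simp add: additive_character_def)

lemma additive_character_add:
  "additive_character R \<psi> \<Longrightarrow> x \<in> carrier R \<Longrightarrow> y \<in> carrier R \<Longrightarrow> \<psi> (x \<oplus>\<^bsub>R\<^esub> y) = \<psi> x * \<psi> y"
  by (simp add: additive_character_def)

lemma additive_character_subset:
  "additive_character R \<psi> \<Longrightarrow> S \<subseteq> carrier R \<Longrightarrow> additive_character (R\<lparr>carrier := S\<rparr>) \<psi>"
  by (auto simp: additive_character_def subset_eq)

lemma additive_character_power:
  "additive_character R \<psi> \<Longrightarrow> additive_character R (\<lambda>x. \<psi> x ^ n)"
  by (simp add: additive_character_def norm_power power_mult_distrib)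

context ring
begin

lemma additive_character_scale:
  "additive_character R \<psi> \<Longrightarrow> a \<in> carrier R \<Longrightarrow> additive_character R (\<lambda>x. \<psi> (a \<otimes> x))"
  by (simp add: additive_character_def r_distr)

lemma additive_character_zero:
  assumes "additive_character R \<psi>"
  shows "\<psi> \<zero> = 1"
proof -
  have "\<psi> \<zero> * \<psi> \<zero> = \<psi> \<zero> * 1"
    using additive_character_add[OF assms, of \<zero> \<zero>] by simp
  moreover have "\<psi> \<zero> \<noteq> 0"
    using additive_character_norm[OF assms, of \<zero>] by force
  ultimately show ?thesis
    using mult_left_cancel by blast
qed

lemma additive_character_minus:
  assumes \<psi>: "additive_character R \<psi>" and xy: "x \<in> carrier R" "y \<in> carrier R"
  shows "\<psi> (x \<ominus> y) = \<psi> x * cnj (\<psi> y)"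
proof -
  have "\<psi> (x \<ominus> y) * \<psi> y = \<psi> ((x \<ominus> y) \<oplus> y)"
    using xy by (simp add: additive_character_add[OF \<psi>])
  also have "(x \<ominus> y) \<oplus> y = x"
    using xy by (simp add: a_minus_def a_assoc l_neg)
  finally have "\<psi> (x \<ominus> y) * (\<psi> y * cnj (\<psi> y)) = \<psi> x * cnj (\<psi> y)"
    by (metis mult.assoc)
  moreover have "\<psi> y * cnj (\<psi> y) = 1"
    by (simp add: complex_norm_square[symmetric] additive_character_norm[OF \<psi> xy(2)])
  ultimately show ?thesis
    by simp
qed

lemma bij_betw_translation:
  assumes "a \<in> carrier R"
  shows "bij_betw (\<lambda>x. x \<oplus> a) (carrier R) (carrier R)"
  by (rule bij_betw_byWitness[of _ "\<lambda>x. x \<ominus> a"])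
     (use assms in \<open>auto simp: a_minus_def a_assoc l_neg r_neg\<close>)

text \<open>Translation by \<open>y\<close> permutes the carrier and multiplies the sum by
  \<open>\<psi> y\<close>, which is not \<open>1\<close>.\<close>

lemma sum_additive_character_eq_0:
  assumes \<psi>: "additive_character R \<psi>" and y: "y \<in> carrier R" "\<psi> y \<noteq> 1"
  shows "(\<Sum>x\<in>carrier R. \<psi> x) = 0"
proof -
  have "(\<Sum>x\<in>carrier R. \<psi> x) = (\<Sum>x\<in>carrier R. \<psi> (x \<oplus> y))"
    by (rule sum.reindex_bij_betw[OF bij_betw_translation[OF y(1)], symmetric])
  also have "\<dots> = (\<Sum>x\<in>carrier R. \<psi> x) * \<psi> y"
    unfolding sum_distrib_right
    by (rule sum.cong) (use \<psi> y(1) in \<open>auto simp: additive_character_add\<close>)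
  finally show ?thesis
    using y(2) by (metis mult_cancel_left mult.right_neutral)
qed

lemma norm_sum_additive_character:
  assumes "additive_character R \<psi>"
  shows "cmod (\<Sum>x\<in>carrier R. \<psi> x) ^ 2 =
    real (card (carrier R)) ^ 2 * of_bool (\<forall>x\<in>carrier R. \<psi> x = 1)"
  using sum_additive_character_eq_0[OF assms] by (cases "\<forall>x\<in>carrier R. \<psi> x = 1") auto

end

section \<open>Orthogonality, Parseval's identity and Gauss periods\<close>

context field
begin

lemma bij_betw_scale:
  assumes "a \<in> carrier R" "a \<noteq> \<zero>"
  shows "bij_betw (\<lambda>x. a \<otimes> x) (carrier R) (carrier R)"
proof -
  have u: "a \<in> Units R"
    using assms by (simp add: field_Units)
  show ?thesis
    by (rule bij_betw_byWitness[of _ "\<lambda>x. inv a \<otimes> x"])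
       (use assms u in \<open>auto simp: m_assoc[symmetric]\<close>)
qed

text \<open>For nonzero \<open>x\<close>, multiplication by \<open>x\<close> permutes the field,
  which reduces the sum to that of the nontrivial \<open>\<psi>\<close> itself. A single nontrivial
  character thus supplies the orthogonality relations.\<close>

lemma sum_scaled_additive_character:
  assumes \<psi>: "additive_character R \<psi>" "z \<in> carrier R" "\<psi> z \<noteq> 1" and x: "x \<in> carrier R"
  shows "(\<Sum>u\<in>carrier R. \<psi> (u \<otimes> x)) = of_nat (card (carrier R)) * of_bool (x = \<zero>)"
proof (cases "x = \<zero>")
  case True
  then show ?thesis
    by (simp add: additive_character_zero[OF \<psi>(1)])
next
  case False
  have "(\<Sum>u\<in>carrier R. \<psi> (u \<otimes> x)) = (\<Sum>u\<in>carrier R. \<psi> (x \<otimes> u))"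
    by (rule sum.cong) (use x in \<open>auto simp: m_comm\<close>)
  also have "\<dots> = (\<Sum>u\<in>carrier R. \<psi> u)"
    by (rule sum.reindex_bij_betw[OF bij_betw_scale[OF x False]])
  finally show ?thesis
    using False sum_additive_character_eq_0[OF \<psi>] by simp
qed

text \<open>Expanding the square produces \<open>\<psi> (u \<otimes> (x \<ominus> y))\<close>, and
  summing over \<open>u\<close> leaves the diagonal. The set \<open>S\<close> admits functions
  supported on part of the field: it is \<open>H\<close> for Gauss periods and the whole carrier for
  the operator.\<close>

lemma parseval:
  assumes \<psi>: "additive_character R \<psi>" "z \<in> carrier R" "\<psi> z \<noteq> 1"
    and fin: "finite (carrier R)" and S: "S \<subseteq> carrier R"
  shows "(\<Sum>u\<in>carrier R. cmod (\<Sum>x\<in>S. f x * \<psi> (u \<otimes> x)) ^ 2) =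
    real (card (carrier R)) * (\<Sum>x\<in>S. cmod (f x) ^ 2)"
proof -
  let ?n = "of_nat (card (carrier R)) :: complex"
  have finS: "finite S"
    using fin S finite_subset by blast
  have *: "complex_of_real (cmod (\<Sum>x\<in>S. f x * \<psi> (u \<otimes> x)) ^ 2) =
      (\<Sum>x\<in>S. \<Sum>y\<in>S. f x * cnj (f y) * \<psi> (u \<otimes> (x \<ominus> y)))" if u: "u \<in> carrier R" for u
  proof -
    have "\<psi> (u \<otimes> (x \<ominus> y)) = \<psi> (u \<otimes> x) * cnj (\<psi> (u \<otimes> y))"
      if "x \<in> S" "y \<in> S" for x y
      using additive_character_minus[OF additive_character_scale[OF \<psi>(1) u]] that S by blast
    then show ?thesis
      unfolding complex_norm_square cnj_sum sum_product
      by (intro sum.cong) (simp_all add: ac_simps)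
  qed
  have "complex_of_real (\<Sum>u\<in>carrier R. cmod (\<Sum>x\<in>S. f x * \<psi> (u \<otimes> x)) ^ 2) =
      (\<Sum>u\<in>carrier R. \<Sum>x\<in>S. \<Sum>y\<in>S. f x * cnj (f y) * \<psi> (u \<otimes> (x \<ominus> y)))"
    unfolding of_real_sum by (intro sum.cong refl *)
  also have "\<dots> = (\<Sum>x\<in>S. \<Sum>u\<in>carrier R. \<Sum>y\<in>S. f x * cnj (f y) * \<psi> (u \<otimes> (x \<ominus> y)))"
    by (rule sum.swap)
  also have "\<dots> = (\<Sum>x\<in>S. \<Sum>y\<in>S. f x * cnj (f y) * (\<Sum>u\<in>carrier R. \<psi> (u \<otimes> (x \<ominus> y))))"
    unfolding sum_distrib_left by (intro sum.cong refl sum.swap)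
  also have "\<dots> = (\<Sum>x\<in>S. \<Sum>y\<in>S. if x = y then f x * cnj (f x) * ?n else 0)"
  proof (intro sum.cong refl)
    fix x y
    assume "x \<in> S" "y \<in> S"
    then have xy: "x \<in> carrier R" "y \<in> carrier R"
      using S by auto
    then show "f x * cnj (f y) * (\<Sum>u\<in>carrier R. \<psi> (u \<otimes> (x \<ominus> y))) =
        (if x = y then f x * cnj (f x) * ?n else 0)"
      using sum_scaled_additive_character[OF \<psi>, of "x \<ominus> y"] by simp
  qed
  also have "\<dots> = (\<Sum>x\<in>S. f x * cnj (f x) * ?n)"
    using finS by simp
  also have "\<dots> = complex_of_real (real (card (carrier R)) * (\<Sum>x\<in>S. cmod (f x) ^ 2))"
    by (simp add: complex_norm_square sum_distrib_left mult.commute del: of_real_power)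
  finally show ?thesis
    unfolding of_real_eq_iff .
qed

text \<open>Multiplying the argument of \<open>\<psi>\<close> by an element of \<open>H\<close> does not change the sum, so
  its square occurs at least \<open>card H\<close> times in Parseval's identity for the indicator of \<open>H\<close>.\<close>

lemma gauss_period_bound:
  assumes \<psi>: "additive_character R \<psi>" "z \<in> carrier R" "\<psi> z \<noteq> 1"
    and fin: "finite (carrier R)" and H: "subgroup H (Multiplicative_Group.mult_of R)"
  shows "cmod (\<Sum>h\<in>H. \<psi> h) \<le> sqrt (real (card (carrier R)))"
proof -
  interpret M: Group.group "Multiplicative_Group.mult_of R"
    by (rule field_mult_group)
  have HR: "H \<subseteq> carrier R" "\<zero> \<notin> H"
    using subgroup.subset[OF H] by auto
  have finH: "finite H"
    using fin HR(1) finite_subset by blast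
  have pos: "card H > 0"
    using finH subgroup.one_closed[OF H] by (auto simp: card_gt_0_iff)
  have inv: "(\<Sum>h\<in>H. \<psi> (u \<otimes> h)) = (\<Sum>h\<in>H. \<psi> h)" if u: "u \<in> H" for u
  proof -
    have "inj_on (\<lambda>x. u \<otimes> x) H"
      by (rule inj_on_subset[OF bij_betw_imp_inj_on[OF bij_betw_scale] HR(1)]) (use u HR in auto)
    moreover have "(\<lambda>x. u \<otimes> x) ` H \<subseteq> H"
      using subgroup.m_closed[OF H u] by auto
    ultimately have "bij_betw (\<lambda>x. u \<otimes> x) H H"
      using finH by (simp add: bij_betw_def endo_inj_surj)
    then show ?thesis
      by (rule sum.reindex_bij_betw)
  qed
  have "real (card H) * cmod (\<Sum>h\<in>H. \<psi> h) ^ 2 = (\<Sum>u\<in>H. cmod (\<Sum>h\<in>H. 1 * \<psi> (u \<otimes> h)) ^ 2)"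
    using inv by simp
  also have "\<dots> \<le> (\<Sum>u\<in>carrier R. cmod (\<Sum>h\<in>H. 1 * \<psi> (u \<otimes> h)) ^ 2)"
    using fin HR(1) by (intro sum_mono2) auto
  also have "\<dots> = real (card H) * real (card (carrier R))"
    by (subst parseval[OF \<psi> fin HR(1)]) simp
  finally have "cmod (\<Sum>h\<in>H. \<psi> h) ^ 2 \<le> real (card (carrier R))"
    using pos by simp
  then show ?thesis
    by (simp add: real_le_rsqrt)
qed

text \<open>Since \<open>\<psi> h\<close> is a \<open>p\<close>-th root of unity, the sum of
  \<open>\<psi> h ^ t\<close> over \<open>t < p\<close> is \<open>p\<close> on the kernel and
  \<open>0\<close> off it. The exponent \<open>t = 0\<close> gives the main term; the other
  exponents give Gauss periods of nontrivial characters.\<close>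

lemma card_additive_character_kernel_le:
  assumes \<psi>: "additive_character R \<psi>" "z \<in> carrier R" "\<psi> z \<noteq> 1"
    and fin: "finite (carrier R)" and H: "subgroup H (Multiplicative_Group.mult_of R)"
    and p: "Factorial_Ring.prime p" "\<And>x. x \<in> carrier R \<Longrightarrow> \<psi> x ^ p = 1"
  shows "real (card {h\<in>H. \<psi> h = 1}) \<le> real (card H) / real p + sqrt (real (card (carrier R)))"
proof -
  let ?s = "sqrt (real (card (carrier R)))"
  have HR: "H \<subseteq> carrier R"
    using subgroup.subset[OF H] by auto
  have finH: "finite H"
    using fin HR finite_subset by blast
  have p0: "p > 0"
    using p(1) prime_gt_0_nat by blast
  have bound: "cmod (\<Sum>h\<in>H. \<psi> h ^ t) \<le> ?s" if t: "t \<in> {1..<p}" for t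
  proof -
    \<comment> \<open>The power stays nontrivial at the same \<open>z\<close>: Bezout gives an
      inverse \<open>a\<close> of \<open>t\<close> modulo \<open>p\<close>, and raising to the power
      \<open>a\<close> recovers \<open>\<psi> z\<close>.\<close>
    have "coprime t p"
      using p(1) t prime_imp_coprime[of p t] by (simp add: coprime_commute nat_dvd_not_less)
    moreover have "t \<noteq> 0"
      using t by simp
    ultimately obtain a b where ab: "t * a = p * b + 1"
      using bezout_nat[of t p] by (auto simp: coprime_iff_gcd_eq_1)
    have "\<psi> z ^ t \<noteq> 1"
    proof
      assume "\<psi> z ^ t = 1"
      then have "1 = \<psi> z ^ (t * a)"
        by (simp add: power_mult)
      also have "\<dots> = \<psi> z"
        by (simp add: ab power_add power_mult p(2)[OF \<psi>(2)])
      finally show False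
        using \<psi>(3) by simp
    qed
    then show ?thesis
      by (rule gauss_period_bound[OF additive_character_power[OF \<psi>(1)] \<psi>(2) _ fin H])
  qed
  have geo: "(\<Sum>t<p. \<psi> h ^ t) = of_nat p * of_bool (\<psi> h = 1)" if "h \<in> H" for h
    using geometric_sum[of "\<psi> h" p] p(2)[of h] that HR by (cases "\<psi> h = 1") auto
  have eq: "complex_of_real (real p * real (card {h\<in>H. \<psi> h = 1})) =
      of_nat (card H) + (\<Sum>t\<in>{1..<p}. \<Sum>h\<in>H. \<psi> h ^ t)"
  proof -
    have "complex_of_real (real p * real (card {h\<in>H. \<psi> h = 1})) =
        (\<Sum>h\<in>H. of_nat p * of_bool (\<psi> h = 1))"
      using finH by (simp add: sum_distrib_left[symmetric] sum.If_cases of_bool_def Int_def)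
    also have "\<dots> = (\<Sum>h\<in>H. \<Sum>t<p. \<psi> h ^ t)"
      by (rule sum.cong) (simp_all add: geo)
    also have "\<dots> = (\<Sum>t<p. \<Sum>h\<in>H. \<psi> h ^ t)"
      by (rule sum.swap)
    also have "{..<p} = insert 0 {1..<p}"
      using p0 by auto
    also have "(\<Sum>t\<in>insert 0 {1..<p}. \<Sum>h\<in>H. \<psi> h ^ t) = of_nat (card H) + (\<Sum>t\<in>{1..<p}. \<Sum>h\<in>H. \<psi> h ^ t)"
      by simp
    finally show ?thesis .
  qed
  have "real p * real (card {h\<in>H. \<psi> h = 1}) =
      cmod (complex_of_real (real p * real (card {h\<in>H. \<psi> h = 1})))"
    unfolding norm_of_real by simp
  also note eq
  also have "cmod (of_nat (card H) + (\<Sum>t\<in>{1..<p}. \<Sum>h\<in>H. \<psi> h ^ t)) \<le>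
      cmod (of_nat (card H)) + (\<Sum>t\<in>{1..<p}. ?s)"
    by (intro norm_triangle_mono order_refl sum_norm_le bound)
  also have "\<dots> = real (card H) + (\<Sum>t\<in>{1..<p}. ?s)"
    by simp
  \<comment> \<open>The \<open>p - 1\<close> error terms are bounded as if there were
    \<open>p\<close>, so that division by \<open>p\<close> leaves a single square root.\<close>
  also have "\<dots> \<le> real (card H) + real p * ?s"
    by (simp add: mult_right_mono)
  finally show ?thesis
    using p0 by (simp add: field_simps)
qed

end

section \<open>A nontrivial character in prime characteristic\<close>

context ring
begin

text \<open>The character is trivial on a maximal proper additive subgroup \<open>M\<close>, and its value at \<open>y\<close>
  is determined by the multiple of a fixed element outside \<open>M\<close> that is congruent to \<open>y\<close>.\<close>

lemma exists_nontrivial_additive_character: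
  fixes p :: nat
  assumes fin: "finite (carrier R)" and ne: "\<one> \<noteq> \<zero>"
    and p: "Factorial_Ring.prime p" "\<And>x. x \<in> carrier R \<Longrightarrow> [p] \<cdot> x = \<zero>"
  shows "\<exists>\<psi> z. additive_character R \<psi> \<and> z \<in> carrier R \<and> \<psi> z \<noteq> 1"
proof -
  define \<M> where "\<M> = {M. subgroup M (add_monoid R) \<and> M \<noteq> carrier R}"
  have "finite \<M>"
    by (rule finite_subset[of _ "Pow (carrier R)"])
       (use fin subgroup.subset[of _ "add_monoid R"] in \<open>auto simp: \<M>_def\<close>)
  \<comment> \<open>As \<open>\<one> \<noteq> \<zero>\<close>, the zero subgroup is proper, so the
    finite family has a maximal member.\<close>
  moreover have "{\<zero>} \<in> \<M>"
    using ne add.triv_subgroup by (auto simp: \<M>_def)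
  ultimately obtain M where M: "M \<in> \<M>" "\<And>N. N \<in> \<M> \<Longrightarrow> M \<subseteq> N \<Longrightarrow> M = N"
    by (metis finite_has_maximal empty_iff)
  then have Msub: "subgroup M (add_monoid R)" and MR: "M \<subseteq> carrier R" "M \<noteq> carrier R"
    using subgroup.subset[of M "add_monoid R"] by (auto simp: \<M>_def)
  have M0: "\<zero> \<in> M"
    using subgroup.one_closed[OF Msub] by simp
  have Madd: "x \<oplus> y \<in> M" if "x \<in> M" "y \<in> M" for x y
    using subgroup.m_closed[OF Msub that] by simp
  have Mneg: "\<ominus> x \<in> M" if "x \<in> M" for x
    using subgroup.m_inv_closed[OF Msub that] by (simp add: a_inv_def)
  obtain e where e: "e \<in> carrier R" "e \<notin> M"
    using MR by blast
  have Mmult: "[k] \<cdot> x \<in> M" if "x \<in> M" for x and k :: int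
    using add.subgroup_int_pow_closed[OF Msub that] by (simp add: add_pow_def)
  have pe: "[(int p * k)] \<cdot> e = \<zero>" for k
  proof -
    have "[int p] \<cdot> e = \<zero>"
      using p(2)[OF e(1)] by (simp add: add_pow_int_ge)
    then show ?thesis
      using add.int_pow_pow[OF e(1), of k "int p"] by (simp add: mult.commute)
  qed
  \<comment> \<open>Otherwise Bezout writes \<open>e\<close> as a multiple of
    \<open>[k] \<cdot> e\<close> plus a multiple of \<open>[p] \<cdot> e = \<zero>\<close>, which
    would put \<open>e\<close> into \<open>M\<close>.\<close>
  have kM: "int p dvd k" if k: "[k] \<cdot> e \<in> M" for k :: int
  proof (rule ccontr)
    assume "\<not> int p dvd k"
    then have "coprime (int p) k"
      using p(1) by (simp add: prime_imp_coprime)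
    then obtain u v where uv: "u * int p + v * k = 1"
      by (metis bezout_int coprime_iff_gcd_eq_1)
    have "[(v * k)] \<cdot> e \<in> M"
      using Mmult[OF k, of v] e(1) by (simp add: add.int_pow_pow mult.commute)
    moreover have "[(v * k)] \<cdot> e = [(u * int p + v * k)] \<cdot> e"
      using e(1) pe[of u] by (simp add: add.int_pow_mult mult.commute)
    ultimately show False
      using e by (simp add: uv)
  qed
  have z0: "[(0 :: int)] \<cdot> e = \<zero>" and z1: "[(1 :: int)] \<cdot> e = e"
    using e(1) add.int_pow_1[of e] by (simp_all add: add_pow_def)
  have zadd: "[(k + l)] \<cdot> e = [k] \<cdot> e \<oplus> [l] \<cdot> e" and zneg: "[(- k)] \<cdot> e = \<ominus> ([k] \<cdot> e)"
    and zc: "[k] \<cdot> e \<in> carrier R" for k l :: int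
    using add.int_pow_mult[OF e(1), of k l] add.int_pow_neg[OF e(1), of k] add.int_pow_closed[OF e(1), of k]
    by (simp_all add: a_inv_def add_pow_def)
  \<comment> \<open>\<open>N\<close> is the subgroup generated by \<open>M\<close> and
    \<open>e\<close>; being strictly larger than \<open>M\<close>, it is the whole carrier by
    maximality.\<close>
  define N where "N = {y \<in> carrier R. \<exists>k::int. y \<ominus> [k] \<cdot> e \<in> M}"
  have N: "subgroup N (add_monoid R)"
  proof (rule add.subgroupI)
    have "\<zero> \<in> N"
      using M0 by (auto simp: N_def a_minus_def z0 intro!: exI[of _ 0])
    then show "N \<subseteq> carrier R" "N \<noteq> {}"
      by (auto simp: N_def)
  next
    fix x assume "x \<in> N"
    then obtain k :: int where k: "x \<in> carrier R" "x \<ominus> [k] \<cdot> e \<in> M"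
      by (auto simp: N_def)
    have "\<ominus> x \<ominus> [(- k)] \<cdot> e = \<ominus> (x \<ominus> [k] \<cdot> e)"
      using k(1) e(1) by (simp add: a_minus_def minus_add zneg zc)
    then show "\<ominus> x \<in> N"
      using k Mneg by (auto simp: N_def intro!: exI[of _ "- k"])
  next
    fix x y assume "x \<in> N" "y \<in> N"
    then obtain k l :: int where kl: "x \<in> carrier R" "x \<ominus> [k] \<cdot> e \<in> M"
        "y \<in> carrier R" "y \<ominus> [l] \<cdot> e \<in> M"
      by (auto simp: N_def)
    have "x \<oplus> y \<ominus> [(k + l)] \<cdot> e = (x \<ominus> [k] \<cdot> e) \<oplus> (y \<ominus> [l] \<cdot> e)"
      using kl e(1) by (simp add: a_minus_def minus_add zadd zc a_ac)
    then show "x \<oplus> y \<in> N"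
      using kl Madd by (auto simp: N_def intro!: exI[of _ "k + l"])
  qed
  have "M \<subseteq> N"
    using MR by (auto simp: N_def a_minus_def z0 intro!: exI[of _ 0])
  moreover have "e \<in> N"
    using e M0 by (auto simp: N_def a_minus_def z1 r_neg intro!: exI[of _ 1])
  ultimately have NR: "N = carrier R"
    using M(2)[of N] N e(2) by (auto simp: \<M>_def)
  define \<kappa> where "\<kappa> y = (SOME k::int. y \<ominus> [k] \<cdot> e \<in> M)" for y
  define \<psi> where "\<psi> y = cis (2 * pi * real_of_int (\<kappa> y) / real p)" for y
  have \<kappa>: "y \<ominus> [(\<kappa> y)] \<cdot> e \<in> M" if "y \<in> carrier R" for y
    unfolding \<kappa>_def by (rule someI_ex) (use that NR in \<open>auto simp: N_def\<close>)
  have p0: "p > 0"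
    using p(1) prime_gt_0_nat by blast
  \<comment> \<open>Independence of the choice made in \<open>\<kappa>\<close>: two admissible
    multiples for \<open>y\<close> differ by some \<open>j\<close> with
    \<open>[j] \<cdot> e \<in> M\<close>, hence by a multiple of \<open>p\<close>, which changes the
    angle by full turns. Additivity follows because \<open>\<kappa> x + \<kappa> y\<close> is
    admissible for \<open>x \<oplus> y\<close>.\<close>
  have \<psi>: "\<psi> y = cis (2 * pi * real_of_int k / real p)"
    if y: "y \<in> carrier R" "y \<ominus> [k] \<cdot> e \<in> M" for y k
  proof -
    have "(y \<ominus> [k] \<cdot> e) \<oplus> \<ominus> (y \<ominus> [(\<kappa> y)] \<cdot> e) = [(\<kappa> y - k)] \<cdot> e"
      using y(1) e(1)
      by (simp add: a_minus_def minus_add zadd zneg zc a_ac r_neg1 r_neg2 diff_conv_add_uminus del: add_uminus_conv_diff)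
    then have "int p dvd \<kappa> y - k"
      using kM Madd[OF y(2) Mneg[OF \<kappa>[OF y(1)]]] by simp
    then obtain j where "\<kappa> y = k + int p * j"
      by (metis dvd_def diff_add_cancel add.commute)
    then have "2 * pi * real_of_int (\<kappa> y) / real p = 2 * pi * real_of_int k / real p + 2 * pi * real_of_int j"
      using p0 by (simp add: field_simps)
    moreover have "cis (2 * pi * real_of_int j) = 1"
      by (rule cis_multiple_2pi) simp
    ultimately show ?thesis
      by (simp add: \<psi>_def cis_mult[symmetric])
  qed
  have "additive_character R \<psi>"
    unfolding additive_character_def
  proof (intro conjI ballI)
    fix x y assume xy: "x \<in> carrier R" "y \<in> carrier R"
    have "x \<oplus> y \<ominus> [(\<kappa> x + \<kappa> y)] \<cdot> e = (x \<ominus> [(\<kappa> x)] \<cdot> e) \<oplus> (y \<ominus> [(\<kappa> y)] \<cdot> e)"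
      using xy e(1) by (simp add: a_minus_def minus_add zadd zc a_ac)
    then have "x \<oplus> y \<ominus> [(\<kappa> x + \<kappa> y)] \<cdot> e \<in> M"
      using Madd[OF \<kappa>[OF xy(1)] \<kappa>[OF xy(2)]] by simp
    from \<psi>[OF _ this] show "\<psi> (x \<oplus> y) = \<psi> x * \<psi> y"
      using xy by (simp add: \<psi>_def cis_mult add_divide_distrib distrib_left)
  qed (simp add: \<psi>_def)
  \<comment> \<open>The multiple \<open>1\<close> is admissible for \<open>e\<close>, so
    \<open>\<psi> e\<close> is \<open>cis (2 * pi / p)\<close>, which differs from \<open>1\<close>
    because \<open>p > 1\<close>.\<close>
  moreover have "\<psi> e \<noteq> 1"
  proof
    assume "\<psi> e = 1"
    moreover have "\<psi> e = cis (2 * pi / real p)"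
      using \<psi>[of e 1] e M0 by (simp add: a_minus_def z1 r_neg)
    ultimately have "cos (2 * pi / real p) = 1"
      by (metis cis.sel(1) one_complex.sel(1))
    then obtain n :: int where "2 * pi / real p = real_of_int n * 2 * pi"
      using cos_one_2pi_int by blast
    then have "1 = real_of_int (n * int p)"
      using p0 by (simp add: field_simps)
    then have "int p dvd 1"
      by (metis dvd_triv_right of_int_eq_1_iff)
    then show False
      using p(1) prime_gt_1_nat[of p] by simp
  qed
  ultimately show ?thesis
    using e(1) by blast
qed

lemma additive_character_power_eq_1:
  fixes n :: nat
  assumes \<psi>: "additive_character R \<psi>" and x: "x \<in> carrier R" "[n] \<cdot> x = \<zero>"
  shows "\<psi> x ^ n = 1"
proof -
  have "\<psi> ([n] \<cdot> x) = \<psi> x ^ n" for n :: nat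
    by (induction n) (use x in \<open>simp_all add: additive_character_zero[OF \<psi>] additive_character_add[OF \<psi>]\<close>)
  then show ?thesis
    by (metis x(2) additive_character_zero[OF \<psi>])
qed

end

text \<open>The characteristic is the additive order of \<open>\<one>\<close>, and
  \<open>[n] \<cdot> x\<close> equals \<open>([n] \<cdot> \<one>) \<otimes> x\<close>.\<close>

lemma (in domain) add_pow_ring_characteristic:
  assumes "x \<in> carrier R"
  shows "[(ring_characteristic R)] \<cdot> x = \<zero>"
proof -
  have "[(ring_characteristic R)] \<cdot> \<one> = \<zero>"
    using add.pow_ord_eq_1[of \<one>] by (simp add: ring_characteristic_def add_pow_def)
  then show ?thesis
    using assms add_pow_ldistr[of \<one> x "ring_characteristic R"] by simp
qed

section \<open>Coset operators of finite groups\<close>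

context Group.group
begin

lemma rcoset_eq_iff:
  assumes K: "subgroup K G" and Z: "Z \<in> rcosets K" and x: "x \<in> carrier G"
  shows "K #> x = Z \<longleftrightarrow> x \<in> Z"
proof -
  obtain y where y: "y \<in> carrier G" "Z = K #> y"
    using Z unfolding RCOSETS_def by blast
  show ?thesis
    unfolding y(2) using rcos_self[OF x K] repr_independence[OF _ y(1) K, of x] by blast
qed

text \<open>The cosets partition the group into blocks of size \<open>card K\<close>. This turns
  sums over vertices into sums over group elements, so no representatives have to be chosen. The
  semiring type covers both real norms and complex inner products.\<close>

lemma sum_rcosets:
  fixes F :: "'a set \<Rightarrow> 'c :: comm_semiring_1"
  assumes fin: "finite (carrier G)" and K: "subgroup K G"
  shows "(\<Sum>x\<in>carrier G. F (K #> x)) = of_nat (card K) * (\<Sum>Z\<in>rcosets K. F Z)"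
proof -
  have sub: "K \<subseteq> carrier G"
    using K by (rule subgroup.subset)
  have ZG: "Z \<subseteq> carrier G" if "Z \<in> rcosets K" for Z
    using that rcosets_part_G[OF K] by blast
  have *: "{x \<in> carrier G. K #> x = Z} = Z" if "Z \<in> rcosets K" for Z
    using rcoset_eq_iff[OF K that] ZG[OF that] by blast
  have finr: "finite (rcosets K)"
    by (rule finite_subset[of _ "Pow (carrier G)"]) (use ZG fin in auto)
  have "(\<Sum>x\<in>carrier G. F (K #> x)) =
      (\<Sum>Z\<in>rcosets K. \<Sum>x\<in>{x \<in> carrier G. K #> x = Z}. F (K #> x))"
    by (rule sum.group[symmetric, OF fin finr]) (use sub rcosetsI in auto)
  also have "\<dots> = (\<Sum>Z\<in>rcosets K. of_nat (card Z) * F Z)"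
  proof (rule sum.cong[OF refl])
    fix Z
    assume "Z \<in> rcosets K"
    then have "(\<Sum>x\<in>{x \<in> carrier G. K #> x = Z}. F (K #> x)) = (\<Sum>x\<in>{x \<in> carrier G. K #> x = Z}. F Z)"
      by (intro sum.cong) auto
    then show "(\<Sum>x\<in>{x \<in> carrier G. K #> x = Z}. F (K #> x)) = of_nat (card Z) * F Z"
      by (simp add: *[OF \<open>Z \<in> rcosets K\<close>])
  qed
  also have "\<dots> = (\<Sum>Z\<in>rcosets K. of_nat (card K) * F Z)"
    by (rule sum.cong) (use card_rcosets_equal[OF _ sub] in auto)
  finally show ?thesis
    by (simp add: sum_distrib_left)
qed

lemma sum_rcoset:
  assumes "K \<subseteq> carrier G" "x \<in> carrier G"
  shows "(\<Sum>y\<in>K #> x. F y) = (\<Sum>k\<in>K. F (k \<otimes> x))"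
proof -
  have "K #> x = (\<lambda>k. k \<otimes> x) ` K"
    by (auto simp: r_coset_def)
  moreover have "inj_on (\<lambda>k. k \<otimes> x) K"
    using assms by (auto simp: inj_on_def subset_eq)
  ultimately show ?thesis
    by (simp add: sum.reindex)
qed

end

section \<open>Norms and inner products on the coset graph as sums over the group\<close>

lemma l2_norm_square: "l2_norm S f ^ 2 = (\<Sum>x\<in>S. cmod (f x) ^ 2)"
  by (simp add: l2_norm_def L2_set_def sum_nonneg)

lemma coset_graph_simps:
  "lverts (coset_graph \<Gamma> G H) = rcosets\<^bsub>subgroup_generated \<Gamma> (G \<union> H)\<^esub> G"
  "rverts (coset_graph \<Gamma> G H) = rcosets\<^bsub>subgroup_generated \<Gamma> (G \<union> H)\<^esub> H"
  "edges (coset_graph \<Gamma> G H) = carrier (subgroup_generated \<Gamma> (G \<union> H))"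
  "lend (coset_graph \<Gamma> G H) = (\<lambda>\<phi>. G #>\<^bsub>subgroup_generated \<Gamma> (G \<union> H)\<^esub> \<phi>)"
  "rend (coset_graph \<Gamma> G H) = (\<lambda>\<phi>. H #>\<^bsub>subgroup_generated \<Gamma> (G \<union> H)\<^esub> \<phi>)"
  by (simp_all add: coset_graph_def Let_def)

text \<open>The edges at a left vertex are the elements of that coset, and the biadjacency entries
  count them by right coset; \<open>sum.group\<close> undoes this grouping. Cosets and products are
  written in \<open>\<Gamma>\<close>, where they agree with those of the generated subgroup.\<close>

lemma coset_operator_rcoset:
  assumes "Group.group \<Gamma>" and fin: "finite (carrier (subgroup_generated \<Gamma> (G \<union> H)))"
    and G: "subgroup G \<Gamma>" and H: "subgroup H \<Gamma>"
    and \<phi>: "\<phi> \<in> carrier (subgroup_generated \<Gamma> (G \<union> H))"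
  shows "coset_operator \<Gamma> G H f (G #>\<^bsub>\<Gamma>\<^esub> \<phi>) =
    complex_of_real (1 / sqrt (real (card G) * real (card H))) * (\<Sum>g\<in>G. f (H #>\<^bsub>\<Gamma>\<^esub> (g \<otimes>\<^bsub>\<Gamma>\<^esub> \<phi>)))"
proof -
  define A where "A = subgroup_generated \<Gamma> (G \<union> H)"
  interpret \<Gamma>: Group.group \<Gamma> by fact
  interpret A: Group.group A
    unfolding A_def by (rule \<Gamma>.group_subgroup_generated)
  have GA: "subgroup G A" and HA: "subgroup H A"
    using G H by (simp_all add: A_def \<Gamma>.subgroup_of_subgroup_generated)
  have finA: "finite (carrier A)" and \<phi>A: "\<phi> \<in> carrier A"
    using fin \<phi> by (simp_all add: A_def)
  have rc: "K #>\<^bsub>\<Gamma>\<^esub> x = K #>\<^bsub>A\<^esub> x" for K x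
    by (simp add: A_def r_coset_def)
  have mA: "(\<otimes>\<^bsub>\<Gamma>\<^esub>) = (\<otimes>\<^bsub>A\<^esub>)"
    by (simp add: A_def)
  define L where "L = G #>\<^bsub>A\<^esub> \<phi>"
  have L: "L \<in> rcosets\<^bsub>A\<^esub> G"
    unfolding L_def by (rule A.rcosetsI[OF subgroup.subset[OF GA] \<phi>A])
  have LA: "L \<subseteq> carrier A"
    using A.rcosets_part_G[OF GA] L by blast
  have finr: "finite (rcosets\<^bsub>A\<^esub> H)"
    by (rule finite_subset[of _ "Pow (carrier A)"]) (use A.rcosets_part_G[OF HA] finA in auto)
  have "(\<Sum>R\<in>rcosets\<^bsub>A\<^esub> H. of_nat (biadj (coset_graph \<Gamma> G H) L R) * f R) =
      (\<Sum>R\<in>rcosets\<^bsub>A\<^esub> H. \<Sum>\<psi>\<in>{\<psi> \<in> L. H #>\<^bsub>A\<^esub> \<psi> = R}. f (H #>\<^bsub>A\<^esub> \<psi>))"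
  proof (rule sum.cong[OF refl])
    fix R
    have "{\<psi> \<in> carrier A. G #>\<^bsub>A\<^esub> \<psi> = L \<and> H #>\<^bsub>A\<^esub> \<psi> = R} = {\<psi> \<in> L. H #>\<^bsub>A\<^esub> \<psi> = R}"
      using A.rcoset_eq_iff[OF GA L] LA by blast
    then show "of_nat (biadj (coset_graph \<Gamma> G H) L R) * f R =
        (\<Sum>\<psi>\<in>{\<psi> \<in> L. H #>\<^bsub>A\<^esub> \<psi> = R}. f (H #>\<^bsub>A\<^esub> \<psi>))"
      by (simp add: biadj_def coset_graph_simps flip: A_def)
  qed
  also have "\<dots> = (\<Sum>\<psi>\<in>L. f (H #>\<^bsub>A\<^esub> \<psi>))"
    by (rule sum.group[OF finite_subset[OF LA finA] finr])
       (use LA A.rcosetsI[OF subgroup.subset[OF HA]] in auto)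
  also have "\<dots> = (\<Sum>g\<in>G. f (H #>\<^bsub>A\<^esub> (g \<otimes>\<^bsub>A\<^esub> \<phi>)))"
    unfolding L_def by (rule A.sum_rcoset[OF subgroup.subset[OF GA] \<phi>A])
  finally show ?thesis
    by (simp add: coset_operator_def coset_graph_simps A_def[symmetric] rc mA L_def)
qed

text \<open>The sum over group elements counts each left vertex \<open>card G\<close> times, and the
  normalization contributes \<open>1 / (card G * card H)\<close>; clearing both gives the factor on
  the left.\<close>

lemma l2_norm_coset_operator:
  assumes "Group.group \<Gamma>" and fin: "finite (carrier (subgroup_generated \<Gamma> (G \<union> H)))"
    and G: "subgroup G \<Gamma>" and H: "subgroup H \<Gamma>"
  shows "real (card G) ^ 2 * real (card H) *
      l2_norm (lverts (coset_graph \<Gamma> G H)) (coset_operator \<Gamma> G H f) ^ 2 =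
    (\<Sum>\<phi>\<in>carrier (subgroup_generated \<Gamma> (G \<union> H)).
      cmod (\<Sum>g\<in>G. f (H #>\<^bsub>\<Gamma>\<^esub> (g \<otimes>\<^bsub>\<Gamma>\<^esub> \<phi>))) ^ 2)"
proof -
  define A where "A = subgroup_generated \<Gamma> (G \<union> H)"
  interpret \<Gamma>: Group.group \<Gamma> by fact
  interpret A: Group.group A
    unfolding A_def by (rule \<Gamma>.group_subgroup_generated)
  have GA: "subgroup G A" and HA: "subgroup H A"
    using G H by (simp_all add: A_def \<Gamma>.subgroup_of_subgroup_generated)
  have finA: "finite (carrier A)"
    using fin by (simp add: A_def)
  have rc: "K #>\<^bsub>\<Gamma>\<^esub> x = K #>\<^bsub>A\<^esub> x" for K x
    by (simp add: A_def r_coset_def)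
  define N where "N = real (card G) * real (card H)"
  have "card G > 0" "card H > 0"
    using finA subgroup.subset[OF GA] subgroup.subset[OF HA] finite_subset
      subgroup.one_closed[OF GA] subgroup.one_closed[OF HA] by (auto simp: card_gt_0_iff)
  then have N: "N > 0"
    by (simp add: N_def)
  have "real (card G) * l2_norm (lverts (coset_graph \<Gamma> G H)) (coset_operator \<Gamma> G H f) ^ 2 =
      real (card G) * (\<Sum>L\<in>rcosets\<^bsub>A\<^esub> G. cmod (coset_operator \<Gamma> G H f L) ^ 2)"
    by (simp add: l2_norm_square coset_graph_simps flip: A_def)
  also have "\<dots> = (\<Sum>\<phi>\<in>carrier A. cmod (coset_operator \<Gamma> G H f (G #>\<^bsub>A\<^esub> \<phi>)) ^ 2)"
    by (rule A.sum_rcosets[OF finA GA, symmetric])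
  also have "\<dots> = (\<Sum>\<phi>\<in>carrier A. (1 / N) * cmod (\<Sum>g\<in>G. f (H #>\<^bsub>\<Gamma>\<^esub> (g \<otimes>\<^bsub>\<Gamma>\<^esub> \<phi>))) ^ 2)"
  proof (rule sum.cong[OF refl])
    fix \<phi>
    assume "\<phi> \<in> carrier A"
    then have "coset_operator \<Gamma> G H f (G #>\<^bsub>A\<^esub> \<phi>) = complex_of_real (1 / sqrt N) *
        (\<Sum>g\<in>G. f (H #>\<^bsub>\<Gamma>\<^esub> (g \<otimes>\<^bsub>\<Gamma>\<^esub> \<phi>)))"
      using coset_operator_rcoset[OF assms, of \<phi> f] by (simp add: A_def[symmetric] N_def rc)
    then show "cmod (coset_operator \<Gamma> G H f (G #>\<^bsub>A\<^esub> \<phi>)) ^ 2 =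
        (1 / N) * cmod (\<Sum>g\<in>G. f (H #>\<^bsub>\<Gamma>\<^esub> (g \<otimes>\<^bsub>\<Gamma>\<^esub> \<phi>))) ^ 2"
      using N by (simp add: norm_mult norm_divide power_mult_distrib power_divide)
  qed
  finally have "N * (real (card G) * l2_norm (lverts (coset_graph \<Gamma> G H)) (coset_operator \<Gamma> G H f) ^ 2) =
      (\<Sum>\<phi>\<in>carrier A. cmod (\<Sum>g\<in>G. f (H #>\<^bsub>\<Gamma>\<^esub> (g \<otimes>\<^bsub>\<Gamma>\<^esub> \<phi>))) ^ 2)"
    using N by (simp add: sum_divide_distrib[symmetric])
  then show ?thesis
    by (simp add: A_def N_def power2_eq_square ac_simps)
qed

text \<open>Each right vertex is counted \<open>card H\<close> times. These two sums later become
  the norm and the mean of a function on \<open>V\<close>.\<close>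

lemma l2_rverts:
  assumes "Group.group \<Gamma>" and fin: "finite (carrier (subgroup_generated \<Gamma> (G \<union> H)))"
    and H: "subgroup H \<Gamma>"
  shows "real (card H) * l2_norm (rverts (coset_graph \<Gamma> G H)) f ^ 2 =
      (\<Sum>\<phi>\<in>carrier (subgroup_generated \<Gamma> (G \<union> H)). cmod (f (H #>\<^bsub>\<Gamma>\<^esub> \<phi>)) ^ 2)"
    and "of_nat (card H) * l2_inner (rverts (coset_graph \<Gamma> G H)) f (\<lambda>_. 1) =
      (\<Sum>\<phi>\<in>carrier (subgroup_generated \<Gamma> (G \<union> H)). f (H #>\<^bsub>\<Gamma>\<^esub> \<phi>))"
proof -
  define A where "A = subgroup_generated \<Gamma> (G \<union> H)"
  interpret \<Gamma>: Group.group \<Gamma> by fact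
  interpret A: Group.group A
    unfolding A_def by (rule \<Gamma>.group_subgroup_generated)
  have HA: "subgroup H A"
    using H by (simp add: A_def \<Gamma>.subgroup_of_subgroup_generated)
  have finA: "finite (carrier A)"
    using fin by (simp add: A_def)
  have rc: "K #>\<^bsub>\<Gamma>\<^esub> x = K #>\<^bsub>A\<^esub> x" for K x
    by (simp add: A_def r_coset_def)
  show "real (card H) * l2_norm (rverts (coset_graph \<Gamma> G H)) f ^ 2 =
      (\<Sum>\<phi>\<in>carrier (subgroup_generated \<Gamma> (G \<union> H)). cmod (f (H #>\<^bsub>\<Gamma>\<^esub> \<phi>)) ^ 2)"
    using A.sum_rcosets[OF finA HA, of "\<lambda>Z. cmod (f Z) ^ 2"]
    by (simp add: l2_norm_square coset_graph_simps rc flip: A_def)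
  show "of_nat (card H) * l2_inner (rverts (coset_graph \<Gamma> G H)) f (\<lambda>_. 1) =
      (\<Sum>\<phi>\<in>carrier (subgroup_generated \<Gamma> (G \<union> H)). f (H #>\<^bsub>\<Gamma>\<^esub> \<phi>))"
    using A.sum_rcosets[OF finA HA, of f]
    by (simp add: l2_inner_def coset_graph_simps rc flip: A_def)
qed

text \<open>The witness is the normalized difference of two point masses. It serves to show that the
  set whose supremum is \<open>sigma2\<close> is nonempty.\<close>

lemma exists_l2_unit_vector_orthogonal_one:
  assumes "finite S" "a \<in> S" "b \<in> S" "a \<noteq> b"
  shows "\<exists>f. l2_inner S f (\<lambda>_. 1) = 0 \<and> l2_norm S f = 1"
proof -
  define f where "f x = complex_of_real (1 / sqrt 2) * (of_bool (x = a) - of_bool (x = b))" for x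
  have "l2_inner S f (\<lambda>_. 1) = 0"
    using assms by (simp add: l2_inner_def f_def sum_divide_distrib[symmetric] sum_subtractf of_bool_def)
  moreover have "cmod (f x) ^ 2 = of_bool (x = a) / 2 + of_bool (x = b) / 2" for x
    using assms(4) by (auto simp: f_def norm_mult norm_divide power_divide)
  then have "l2_norm S f ^ 2 = 1"
    using assms unfolding l2_norm_square
    by (simp add: sum.distrib sum_divide_distrib[symmetric] of_bool_def)
  then have "l2_norm S f = 1"
    by (simp add: l2_norm_def L2_set_def sum_nonneg power2_eq_1_iff)
  ultimately show ?thesis
    by blast
qed

section \<open>Affine maps\<close>

definition affine_map :: "('a, 'r) ring_scheme \<Rightarrow> 'a \<Rightarrow> 'a \<Rightarrow> 'a \<Rightarrow> 'a" where
  "affine_map R a b = (\<lambda>x\<in>carrier R. (a \<otimes>\<^bsub>R\<^esub> x) \<oplus>\<^bsub>R\<^esub> b)"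

context field
begin

lemma affine_map_in_Bij:
  assumes "a \<in> carrier R - {\<zero>}" "b \<in> carrier R"
  shows "affine_map R a b \<in> Bij (carrier R)"
proof -
  have "bij_betw ((\<lambda>x. x \<oplus> b) \<circ> (\<lambda>x. a \<otimes> x)) (carrier R) (carrier R)"
    using assms by (intro bij_betw_trans[OF bij_betw_scale bij_betw_translation]) auto
  then show ?thesis
    by (simp add: Bij_def affine_map_def bij_betw_restrict_eq o_def)
qed

lemma carrier_AGL1:
  "carrier (AGL1 R) = {affine_map R a b | a b. a \<in> carrier R - {\<zero>} \<and> b \<in> carrier R}"
  by (simp add: AGL1_def affine_map_def)

lemma affine_map_in_AGL1:
  "a \<in> carrier R - {\<zero>} \<Longrightarrow> b \<in> carrier R \<Longrightarrow> affine_map R a b \<in> carrier (AGL1 R)"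
  unfolding carrier_AGL1 by blast

lemma affine_map_mult:
  assumes "a \<in> carrier R - {\<zero>}" "b \<in> carrier R" "c \<in> carrier R - {\<zero>}" "d \<in> carrier R"
  shows "affine_map R a b \<otimes>\<^bsub>AGL1 R\<^esub> affine_map R c d = affine_map R (a \<otimes> c) (a \<otimes> d \<oplus> b)"
proof -
  have "affine_map R a b \<otimes>\<^bsub>AGL1 R\<^esub> affine_map R c d =
      compose (carrier R) (affine_map R a b) (affine_map R c d)"
    using assms affine_map_in_Bij by (simp add: AGL1_def BijGroup_def)
  also have "\<dots> = affine_map R (a \<otimes> c) (a \<otimes> d \<oplus> b)"
    using assms by (auto simp: compose_def affine_map_def r_distr m_assoc a_assoc)
  finally show ?thesis .
qed

lemma affine_map_eq_iff:
  assumes "a \<in> carrier R" "b \<in> carrier R" "c \<in> carrier R" "d \<in> carrier R"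
  shows "affine_map R a b = affine_map R c d \<longleftrightarrow> a = c \<and> b = d"
proof
  assume eq: "affine_map R a b = affine_map R c d"
  have "b = d"
    using fun_cong[OF eq, of \<zero>] assms by (simp add: affine_map_def)
  moreover have "a \<oplus> b = c \<oplus> d"
    using fun_cong[OF eq, of \<one>] assms by (simp add: affine_map_def)
  ultimately show "a = c \<and> b = d"
    using assms by simp
qed simp

lemma one_AGL1: "\<one>\<^bsub>AGL1 R\<^esub> = affine_map R \<one> \<zero>"
  by (auto simp: AGL1_def BijGroup_def affine_map_def)

lemma nonzero_mult_closed:
  "a \<in> carrier R - {\<zero>} \<Longrightarrow> b \<in> carrier R - {\<zero>} \<Longrightarrow> a \<otimes> b \<in> carrier R - {\<zero>}"
  using integral by auto

lemma nonzero_inv: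
  assumes "a \<in> carrier R - {\<zero>}"
  shows "inv a \<in> carrier R - {\<zero>}" "inv a \<otimes> a = \<one>" "a \<otimes> inv a = \<one>"
  using assms field_Units Units_inv_Units by auto

lemma group_AGL1: "Group.group (AGL1 R)"
proof (rule groupI)
  fix x y assume "x \<in> carrier (AGL1 R)" "y \<in> carrier (AGL1 R)"
  then obtain a b c d where xy: "a \<in> carrier R - {\<zero>}" "b \<in> carrier R" "x = affine_map R a b"
      "c \<in> carrier R - {\<zero>}" "d \<in> carrier R" "y = affine_map R c d"
    by (auto simp: carrier_AGL1)
  show "x \<otimes>\<^bsub>AGL1 R\<^esub> y \<in> carrier (AGL1 R)"
    unfolding xy(3,6) affine_map_mult[OF xy(1,2,4,5)] carrier_AGL1
    using nonzero_mult_closed[OF xy(1,4)] xy by blast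
  fix z assume "z \<in> carrier (AGL1 R)"
  then obtain e f where z: "e \<in> carrier R - {\<zero>}" "f \<in> carrier R" "z = affine_map R e f"
    by (auto simp: carrier_AGL1)
  show "x \<otimes>\<^bsub>AGL1 R\<^esub> y \<otimes>\<^bsub>AGL1 R\<^esub> z = x \<otimes>\<^bsub>AGL1 R\<^esub> (y \<otimes>\<^bsub>AGL1 R\<^esub> z)"
    using xy z nonzero_mult_closed[of a c] nonzero_mult_closed[of c e]
    by (simp add: affine_map_mult r_distr m_assoc a_assoc)
next
  show "\<one>\<^bsub>AGL1 R\<^esub> \<in> carrier (AGL1 R)"
    by (simp add: one_AGL1 affine_map_in_AGL1)
next
  fix x assume "x \<in> carrier (AGL1 R)"
  then obtain a b where x: "a \<in> carrier R - {\<zero>}" "b \<in> carrier R" "x = affine_map R a b"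
    by (auto simp: carrier_AGL1)
  show "\<one>\<^bsub>AGL1 R\<^esub> \<otimes>\<^bsub>AGL1 R\<^esub> x = x"
    using x by (simp add: one_AGL1 affine_map_mult)
  have "affine_map R (inv a) (\<ominus> (inv a \<otimes> b)) \<otimes>\<^bsub>AGL1 R\<^esub> x = \<one>\<^bsub>AGL1 R\<^esub>"
    using x nonzero_inv[OF x(1)] by (simp add: one_AGL1 affine_map_mult r_neg)
  moreover have "affine_map R (inv a) (\<ominus> (inv a \<otimes> b)) \<in> carrier (AGL1 R)"
    unfolding carrier_AGL1 using x nonzero_inv[OF x(1)] by blast
  ultimately show "\<exists>y\<in>carrier (AGL1 R). y \<otimes>\<^bsub>AGL1 R\<^esub> x = \<one>\<^bsub>AGL1 R\<^esub>"
    by blast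
qed

lemma inv_affine_map:
  assumes "a \<in> carrier R - {\<zero>}" "b \<in> carrier R"
  shows "inv\<^bsub>AGL1 R\<^esub> (affine_map R a b) = affine_map R (inv a) (\<ominus> (inv a \<otimes> b))"
proof (rule group.inv_equality[OF group_AGL1])
  show "affine_map R (inv a) (\<ominus> (inv a \<otimes> b)) \<otimes>\<^bsub>AGL1 R\<^esub> affine_map R a b = \<one>\<^bsub>AGL1 R\<^esub>"
    using assms nonzero_inv[OF assms(1)] by (simp add: one_AGL1 affine_map_mult r_neg)
qed (use assms nonzero_inv[OF assms(1)] in \<open>auto intro: affine_map_in_AGL1\<close>)

text \<open>The semidirect product of \<open>H\<close> with an \<open>H\<close>-stable additive
  subgroup. With \<open>H\<close> trivial it gives the translations, with \<open>W\<close> zero the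
  scalings, and in general an upper bound for the group that both generate.\<close>

lemma subgroup_affine_maps:
  assumes H: "subgroup H (Multiplicative_Group.mult_of R)" and W: "subgroup W (add_monoid R)"
    and HW: "\<And>h w. h \<in> H \<Longrightarrow> w \<in> W \<Longrightarrow> h \<otimes> w \<in> W"
  shows "subgroup {affine_map R h w | h w. h \<in> H \<and> w \<in> W} (AGL1 R)"
proof (rule group.subgroupI[OF group_AGL1])
  have HR: "H \<subseteq> carrier R - {\<zero>}" and WR: "W \<subseteq> carrier R"
    using subgroup.subset[OF H] subgroup.subset[OF W] by auto
  show "{affine_map R h w | h w. h \<in> H \<and> w \<in> W} \<subseteq> carrier (AGL1 R)"
    using HR WR unfolding carrier_AGL1 by blast
  show "{affine_map R h w | h w. h \<in> H \<and> w \<in> W} \<noteq> {}"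
    using subgroup.one_closed[OF H] subgroup.one_closed[OF W] by blast
  fix x assume "x \<in> {affine_map R h w | h w. h \<in> H \<and> w \<in> W}"
  then obtain a b where x: "a \<in> H" "b \<in> W" "x = affine_map R a b"
    by blast
  then have ab: "a \<in> carrier R - {\<zero>}" "b \<in> carrier R"
    using HR WR by auto
  have "inv a \<in> H"
    using subgroup.m_inv_closed[OF H x(1)] ab m_inv_mult_of[of a] by simp
  moreover from this have "\<ominus> (inv a \<otimes> b) \<in> W"
    using subgroup.m_inv_closed[OF W HW] x by (simp add: a_inv_def)
  ultimately show "inv\<^bsub>AGL1 R\<^esub> x \<in> {affine_map R h w | h w. h \<in> H \<and> w \<in> W}"
    unfolding x(3) inv_affine_map[OF ab] by blast
  fix y assume "y \<in> {affine_map R h w | h w. h \<in> H \<and> w \<in> W}"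
  then obtain c d where y: "c \<in> H" "d \<in> W" "y = affine_map R c d"
    by blast
  then have cd: "c \<in> carrier R - {\<zero>}" "d \<in> carrier R"
    using HR WR by auto
  have "a \<otimes> c \<in> H" "a \<otimes> d \<oplus> b \<in> W"
    using subgroup.m_closed[OF H x(1) y(1)] subgroup.m_closed[OF W HW[OF x(1) y(2)] x(2)] by simp_all
  then show "x \<otimes>\<^bsub>AGL1 R\<^esub> y \<in> {affine_map R h w | h w. h \<in> H \<and> w \<in> W}"
    unfolding x(3) y(3) affine_map_mult[OF ab cd] by blast
qed

section \<open>Translations and scalings as subgroups\<close>

lemma translation_maps_eq:
  "G \<subseteq> carrier R \<Longrightarrow> translation_maps R G = affine_map R \<one> ` G"
  unfolding translation_maps_def affine_map_def by (intro image_cong refl restrict_ext) auto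

lemma scaling_maps_eq:
  "H \<subseteq> carrier R \<Longrightarrow> scaling_maps R H = (\<lambda>h. affine_map R h \<zero>) ` H"
  unfolding scaling_maps_def affine_map_def by (intro image_cong refl restrict_ext) auto

lemma subgroup_translation_maps:
  assumes "subgroup G (add_monoid R)"
  shows "subgroup (translation_maps R G) (AGL1 R)"
proof -
  interpret M: Group.group "Multiplicative_Group.mult_of R"
    by (rule field_mult_group)
  have G: "G \<subseteq> carrier R"
    using subgroup.subset[OF assms] by simp
  have "subgroup {affine_map R h w | h w. h \<in> {\<one>} \<and> w \<in> G} (AGL1 R)"
    by (rule subgroup_affine_maps) (use M.triv_subgroup assms G in auto)
  moreover have "{affine_map R h w | h w. h \<in> {\<one>} \<and> w \<in> G} = translation_maps R G"
    by (auto simp: translation_maps_eq[OF G])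
  ultimately show ?thesis
    by simp
qed

lemma subgroup_scaling_maps:
  assumes "subgroup H (Multiplicative_Group.mult_of R)"
  shows "subgroup (scaling_maps R H) (AGL1 R)"
proof -
  have H: "H \<subseteq> carrier R"
    using subgroup.subset[OF assms] by auto
  have "subgroup {affine_map R h w | h w. h \<in> H \<and> w \<in> {\<zero>}} (AGL1 R)"
    by (rule subgroup_affine_maps[OF assms]) (use add.triv_subgroup H in auto)
  moreover have "{affine_map R h w | h w. h \<in> H \<and> w \<in> {\<zero>}} = scaling_maps R H"
    by (auto simp: scaling_maps_eq[OF H])
  ultimately show ?thesis
    by simp
qed

text \<open>Summing over the translates by \<open>a \<otimes> g\<close> is a convolution. On the
  Fourier side it multiplies by the conjugate of the sum of
  \<open>\<psi> (u \<otimes> (a \<otimes> g))\<close> over \<open>g\<close>, whose modulus is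
  \<open>card G\<close> or \<open>0\<close> by orthogonality on \<open>G\<close>; Parseval's
  identity then gives the claim.\<close>

lemma sum_translates:
  assumes \<psi>: "additive_character R \<psi>" "z \<in> carrier R" "\<psi> z \<noteq> 1"
    and fin: "finite (carrier R)" and G: "subring G R" and a: "a \<in> carrier R"
  shows "real (card (carrier R)) * (\<Sum>c\<in>carrier R. cmod (\<Sum>g\<in>G. f (c \<oplus> a \<otimes> g)) ^ 2) =
    (\<Sum>u\<in>carrier R. cmod (\<Sum>x\<in>carrier R. f x * \<psi> (u \<otimes> x)) ^ 2 *
      (real (card G) ^ 2 * of_bool (\<forall>g\<in>G. \<psi> (u \<otimes> (a \<otimes> g)) = 1)))"
proof -
  have GR: "G \<subseteq> carrier R"
    using subringE(1)[OF G] .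
  interpret G: ring "R\<lparr>carrier := G\<rparr>"
    by (rule subring_is_ring[OF G])
  have "(\<Sum>c\<in>carrier R. (\<Sum>g\<in>G. f (c \<oplus> a \<otimes> g)) * \<psi> (u \<otimes> c)) =
      (\<Sum>x\<in>carrier R. f x * \<psi> (u \<otimes> x)) * cnj (\<Sum>g\<in>G. \<psi> (u \<otimes> (a \<otimes> g)))"
    if u: "u \<in> carrier R" for u
  proof -
    have "(\<Sum>c\<in>carrier R. (\<Sum>g\<in>G. f (c \<oplus> a \<otimes> g)) * \<psi> (u \<otimes> c)) =
        (\<Sum>g\<in>G. \<Sum>c\<in>carrier R. f (c \<oplus> a \<otimes> g) * \<psi> (u \<otimes> c))"
      unfolding sum_distrib_right by (rule sum.swap)
    also have "\<dots> = (\<Sum>g\<in>G. \<Sum>x\<in>carrier R. f x * \<psi> (u \<otimes> x) * cnj (\<psi> (u \<otimes> (a \<otimes> g))))"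
    proof (rule sum.cong[OF refl])
      fix g assume "g \<in> G"
      then have ag: "a \<otimes> g \<in> carrier R"
        using GR a by auto
      have "(\<Sum>c\<in>carrier R. f (c \<oplus> a \<otimes> g) * \<psi> (u \<otimes> c)) =
          (\<Sum>c\<in>carrier R. f (c \<oplus> a \<otimes> g) * \<psi> (u \<otimes> ((c \<oplus> a \<otimes> g) \<ominus> a \<otimes> g)))"
        by (rule sum.cong) (use ag in \<open>auto simp: a_minus_def a_assoc r_neg\<close>)
      also have "\<dots> = (\<Sum>x\<in>carrier R. f x * \<psi> (u \<otimes> (x \<ominus> a \<otimes> g)))"
        by (rule sum.reindex_bij_betw[OF bij_betw_translation[OF ag]])
      also have "\<dots> = (\<Sum>x\<in>carrier R. f x * \<psi> (u \<otimes> x) * cnj (\<psi> (u \<otimes> (a \<otimes> g))))"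
        using additive_character_minus[OF additive_character_scale[OF \<psi>(1) u] _ ag]
        by (intro sum.cong) auto
      finally show "(\<Sum>c\<in>carrier R. f (c \<oplus> a \<otimes> g) * \<psi> (u \<otimes> c)) =
          (\<Sum>x\<in>carrier R. f x * \<psi> (u \<otimes> x) * cnj (\<psi> (u \<otimes> (a \<otimes> g))))" .
    qed
    also have "\<dots> = (\<Sum>x\<in>carrier R. f x * \<psi> (u \<otimes> x)) * cnj (\<Sum>g\<in>G. \<psi> (u \<otimes> (a \<otimes> g)))"
      unfolding cnj_sum sum_product by (rule sum.swap)
    finally show ?thesis .
  qed
  moreover have "cmod (\<Sum>g\<in>G. \<psi> (u \<otimes> (a \<otimes> g))) ^ 2 =
      real (card G) ^ 2 * of_bool (\<forall>g\<in>G. \<psi> (u \<otimes> (a \<otimes> g)) = 1)" if u: "u \<in> carrier R" for u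
  proof -
    \<comment> \<open>Orthogonality is applied in the ring with carrier \<open>G\<close>, to the
      restriction of a twice rescaled character.\<close>
    have "additive_character (R\<lparr>carrier := G\<rparr>) (\<lambda>g. \<psi> (u \<otimes> (a \<otimes> g)))"
      using additive_character_scale[OF additive_character_scale[OF \<psi>(1) u] a]
      by (rule additive_character_subset[OF _ GR])
    from G.norm_sum_additive_character[OF this] show ?thesis
      by simp
  qed
  ultimately show ?thesis
    using parseval[OF \<psi> fin order_refl, of "\<lambda>c. \<Sum>g\<in>G. f (c \<oplus> a \<otimes> g)"]
    by (simp add: norm_mult power_mult_distrib del: cnj_sum)
qed

end

section \<open>The coset graph of translations and scalings\<close>

lemma (in Group.group) rcoset_mult_absorb:
  assumes "subgroup K G" "k \<in> K" "x \<in> carrier G"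
  shows "K #> (k \<otimes> x) = K #> x"
  using repr_independence[OF rcosI[OF assms(2) subgroup.subset[OF assms(1)] assms(3)] assms(3,1)] by simp

text \<open>The Fourier argument, up to \<open>sigma2_le\<close>, runs for any subring and any
  multiplicative subgroup; the subfield containing \<open>H\<close> enters afterwards, through the
  kernel estimate.\<close>

locale affine_coset_graph = field +
  fixes G H
  assumes finite_carrier: "finite (carrier R)"
    and G: "subring G R"
    and H: "subgroup H (Multiplicative_Group.mult_of R)"
begin

abbreviation "A \<equiv> subgroup_generated (AGL1 R) (translation_maps R G \<union> scaling_maps R H)"
abbreviation "B \<equiv> coset_graph (AGL1 R) (translation_maps R G) (scaling_maps R H)"

text \<open>The translations in \<open>A\<close>; each right coset of the scalings contains exactly one of them, so
  functions on these cosets are functions on \<open>V\<close>.\<close>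

definition V where "V = {c \<in> carrier R. affine_map R \<one> c \<in> carrier A}"

lemma G_subset: "G \<subseteq> carrier R"
  using subringE(1)[OF G] .

lemma H_subset: "H \<subseteq> carrier R - {\<zero>}"
  using subgroup.subset[OF H] by simp

lemma translations_eq: "translation_maps R G = affine_map R \<one> ` G"
  by (rule translation_maps_eq[OF G_subset])

lemma scalings_eq: "scaling_maps R H = (\<lambda>h. affine_map R h \<zero>) ` H"
  by (rule scaling_maps_eq) (use H_subset in blast)

lemma one_in_H: "\<one> \<in> H"
  using subgroup.one_closed[OF H] by simp

lemma inv_in_H: "h \<in> H \<Longrightarrow> inv h \<in> H"
  using subgroup.m_inv_closed[OF H, of h] H_subset m_inv_mult_of[of h] by (simp add: subset_eq)

lemma finite_H: "finite H"
  using finite_subset[OF _ finite_carrier] H_subset by blast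

lemma subgroup_translations: "subgroup (translation_maps R G) (AGL1 R)"
  by (rule subgroup_translation_maps[OF subring.axioms(1)[OF G]])

lemma subgroup_scalings: "subgroup (scaling_maps R H) (AGL1 R)"
  by (rule subgroup_scaling_maps[OF H])

lemma group_A: "Group.group A"
  by (rule group.group_subgroup_generated[OF group_AGL1])

lemma A_subset: "carrier A \<subseteq> carrier (AGL1 R)"
  by (rule group.carrier_subgroup_generated_subset[OF group_AGL1])

lemma finite_A: "finite (carrier A)"
proof (rule finite_subset[OF A_subset])
  have "carrier (AGL1 R) \<subseteq> (\<lambda>(a, b). affine_map R a b) ` (carrier R \<times> carrier R)"
    by (auto simp: carrier_AGL1)
  then show "finite (carrier (AGL1 R))"
    by (rule finite_subset) (simp add: finite_carrier)
qed

lemma A_mult: "x \<in> carrier A \<Longrightarrow> y \<in> carrier A \<Longrightarrow> x \<otimes>\<^bsub>AGL1 R\<^esub> y \<in> carrier A"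
  using monoid.m_closed[OF group.is_monoid[OF group_A]] by simp

lemma generators_in_A: "translation_maps R G \<union> scaling_maps R H \<subseteq> carrier A"
  using subgroup.subset[OF subgroup_translations] subgroup.subset[OF subgroup_scalings]
  by (intro group.subgroup_generated_subset_carrier_subset[OF group_AGL1]) auto

lemma scaling_in_A: "h \<in> H \<Longrightarrow> affine_map R h \<zero> \<in> carrier A"
  using generators_in_A by (auto simp: scalings_eq)

lemma translation_in_A: "g \<in> G \<Longrightarrow> affine_map R \<one> g \<in> carrier A"
  using generators_in_A by (auto simp: translations_eq)

text \<open>The right side is a subgroup containing all generators, so words in the generators need
  not be described. \<open>W\<close> is the whole field in \<open>bij_betw_A\<close> and a set on
  which a character is trivial in \<open>character_trivial_on_V\<close>.\<close>

lemma A_minimal: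
  assumes W: "subgroup W (add_monoid R)" "G \<subseteq> W"
    and HW: "\<And>h w. h \<in> H \<Longrightarrow> w \<in> W \<Longrightarrow> h \<otimes> w \<in> W"
  shows "carrier A \<subseteq> {affine_map R h w | h w. h \<in> H \<and> w \<in> W}"
proof (rule group.subgroup_generated_minimal[OF group_AGL1 subgroup_affine_maps[OF H W(1) HW]])
  have "\<zero> \<in> W"
    using subgroup.one_closed[OF W(1)] by simp
  then show "translation_maps R G \<union> scaling_maps R H \<subseteq> {affine_map R h w | h w. h \<in> H \<and> w \<in> W}"
    using one_in_H W(2) by (auto simp: translations_eq scalings_eq)
qed

lemma affine_map_decomp:
  assumes "h \<in> H" "c \<in> carrier R"
  shows "affine_map R h (h \<otimes> c) = affine_map R h \<zero> \<otimes>\<^bsub>AGL1 R\<^esub> affine_map R \<one> c"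
  using assms H_subset by (subst affine_map_mult) auto

lemma V_subset: "V \<subseteq> carrier R"
  by (auto simp: V_def)

text \<open>Slopes of elements of \<open>A\<close> lie in \<open>H\<close>, so composing with a
  scaling in \<open>A\<close> makes the slope \<open>\<one>\<close> and leaves a translation by an
  element of \<open>V\<close>. The constant term has the form \<open>h \<otimes> c\<close> because
  the translation by \<open>c\<close> is performed before the scaling.\<close>

lemma bij_betw_A: "bij_betw (\<lambda>(h, c). affine_map R h (h \<otimes> c)) (H \<times> V) (carrier A)"
proof -
  have "inj_on (\<lambda>(h, c). affine_map R h (h \<otimes> c)) (H \<times> V)"
    using H_subset V_subset by (auto simp: inj_on_def affine_map_eq_iff m_lcancel subset_eq)
  moreover have "(\<lambda>(h, c). affine_map R h (h \<otimes> c)) ` (H \<times> V) \<subseteq> carrier A"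
    using affine_map_decomp A_mult scaling_in_A by (auto simp: V_def)
  moreover have "\<phi> \<in> (\<lambda>(h, c). affine_map R h (h \<otimes> c)) ` (H \<times> V)" if \<phi>: "\<phi> \<in> carrier A" for \<phi>
  proof -
    have "carrier A \<subseteq> {affine_map R h w | h w. h \<in> H \<and> w \<in> carrier R}"
      by (rule A_minimal) (use add.subgroup_self G_subset H_subset in auto)
    then obtain h b where hb: "h \<in> H" "b \<in> carrier R" "\<phi> = affine_map R h b"
      using \<phi> by blast
    have h: "h \<in> carrier R - {\<zero>}"
      using hb(1) H_subset by blast
    have "affine_map R \<one> (inv h \<otimes> b) = affine_map R (inv h) \<zero> \<otimes>\<^bsub>AGL1 R\<^esub> \<phi>"
      using h hb nonzero_inv[OF h] by (simp add: affine_map_mult)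
    also have "\<dots> \<in> carrier A"
      by (rule A_mult[OF scaling_in_A[OF inv_in_H[OF hb(1)]] \<phi>])
    finally have "inv h \<otimes> b \<in> V"
      using h hb nonzero_inv[OF h] by (simp add: V_def)
    moreover have "\<phi> = affine_map R h (h \<otimes> (inv h \<otimes> b))"
      using h hb nonzero_inv[OF h] by (simp add: m_assoc[symmetric])
    ultimately show ?thesis
      using hb(1) by force
  qed
  ultimately show ?thesis
    unfolding bij_betw_def by blast
qed

text \<open>Conjugating the translation by \<open>g\<close> with the scaling by \<open>h\<close>
  gives the translation by \<open>inv h \<otimes> g\<close>, which therefore belongs to
  \<open>A\<close>.\<close>

lemma V_translate:
  assumes "c \<in> V" "h \<in> H" "g \<in> G"
  shows "c \<oplus> inv h \<otimes> g \<in> V"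
proof -
  have h: "h \<in> carrier R - {\<zero>}" and g: "g \<in> carrier R" and c: "c \<in> carrier R"
    using assms H_subset G_subset V_subset by auto
  have "affine_map R \<one> (c \<oplus> inv h \<otimes> g) = affine_map R (inv h) \<zero> \<otimes>\<^bsub>AGL1 R\<^esub>
      (affine_map R \<one> g \<otimes>\<^bsub>AGL1 R\<^esub> (affine_map R h \<zero> \<otimes>\<^bsub>AGL1 R\<^esub> affine_map R \<one> c))"
    using h g c nonzero_inv[OF h] by (simp add: affine_map_mult r_distr m_assoc[symmetric])
  also have "\<dots> \<in> carrier A"
    using assms by (intro A_mult) (simp_all add: V_def scaling_in_A translation_in_A inv_in_H)
  finally show ?thesis
    using h g c nonzero_inv[OF h] by (simp add: V_def)
qed

text \<open>The elements \<open>w\<close> with \<open>\<chi> (h \<otimes> w) = 1\<close> for all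
  \<open>h\<close> in \<open>H\<close> form an additive subgroup containing \<open>G\<close>, and
  \<open>A_minimal\<close> confines the constant terms of \<open>A\<close> to it. Quantifying over
  \<open>h\<close> makes this subgroup \<open>H\<close>-stable; the kernel of \<open>\<chi>\<close>
  alone need not be.\<close>

lemma character_trivial_on_V:
  assumes \<chi>: "additive_character R \<chi>" and triv: "\<And>h g. h \<in> H \<Longrightarrow> g \<in> G \<Longrightarrow> \<chi> (h \<otimes> g) = 1"
    and c: "c \<in> V"
  shows "\<chi> c = 1"
proof -
  define W where "W = {w \<in> carrier R. \<forall>h\<in>H. \<chi> (h \<otimes> w) = 1}"
  have HR: "h \<in> carrier R" if "h \<in> H" for h
    using that H_subset by blast
  have "carrier A \<subseteq> {affine_map R h w | h w. h \<in> H \<and> w \<in> W}"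
  proof (rule A_minimal)
    show "subgroup W (add_monoid R)"
    proof (rule add.subgroupI)
      show "W \<subseteq> carrier R"
        by (auto simp: W_def)
      have "\<zero> \<in> W"
        using HR by (auto simp: W_def additive_character_zero[OF \<chi>])
      then show "W \<noteq> {}"
        by blast
    next
      fix x assume x: "x \<in> W"
      have "\<chi> (h \<otimes> (\<ominus> x)) = 1" if h: "h \<in> H" for h
        using additive_character_minus[OF additive_character_scale[OF \<chi> HR[OF h]], of \<zero> x] x h
        by (simp add: W_def a_minus_def HR additive_character_zero[OF \<chi>])
      then show "\<ominus> x \<in> W"
        using x by (simp add: W_def)
    next
      fix x y assume "x \<in> W" "y \<in> W"
      then show "x \<oplus> y \<in> W"
        using HR by (simp add: W_def r_distr additive_character_add[OF \<chi>])
    qed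
    show "G \<subseteq> W"
      using triv G_subset by (auto simp: W_def)
    fix h w assume hw: "h \<in> H" "w \<in> W"
    have "\<chi> (k \<otimes> (h \<otimes> w)) = 1" if "k \<in> H" for k
      using hw that subgroup.m_closed[OF H that hw(1)] by (simp add: W_def HR m_assoc[symmetric])
    then show "h \<otimes> w \<in> W"
      using hw by (simp add: W_def HR)
  qed
  moreover have "affine_map R \<one> c \<in> carrier A"
    using c by (simp add: V_def)
  ultimately obtain h w where hw: "h \<in> H" "w \<in> W" "affine_map R \<one> c = affine_map R h w"
    by blast
  then have "c = w"
    using affine_map_eq_iff[of \<one> c h w] HR c V_subset by (auto simp: W_def)
  then have "\<chi> (\<one> \<otimes> c) = 1"
    using hw(2) one_in_H by (auto simp: W_def)
  then show ?thesis
    using c V_subset by auto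
qed

section \<open>The Fourier bound for the operator\<close>

lemma card_translations: "card (translation_maps R G) = card G"
  and sum_translations: "(\<Sum>\<phi>\<in>translation_maps R G. F \<phi>) = (\<Sum>g\<in>G. F (affine_map R \<one> g))"
proof -
  have "inj_on (affine_map R \<one>) G"
    using G_subset by (auto simp: inj_on_def affine_map_eq_iff subset_eq)
  then show "card (translation_maps R G) = card G"
    and "(\<Sum>\<phi>\<in>translation_maps R G. F \<phi>) = (\<Sum>g\<in>G. F (affine_map R \<one> g))"
    by (simp_all add: translations_eq card_image sum.reindex)
qed

lemma card_scalings: "card (scaling_maps R H) = card H"
proof -
  have "inj_on (\<lambda>h. affine_map R h \<zero>) H"
    using H_subset by (auto simp: inj_on_def affine_map_eq_iff subset_eq)
  then show ?thesis
    by (simp add: scalings_eq card_image)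
qed

lemma sum_A: "(\<Sum>\<phi>\<in>carrier A. F \<phi>) = (\<Sum>h\<in>H. \<Sum>c\<in>V. F (affine_map R h (h \<otimes> c)))"
  using sum.reindex_bij_betw[OF bij_betw_A, of F]
  by (simp add: sum.cartesian_product split_def)

lemma rcoset_scalings:
  assumes "h \<in> H" "c \<in> carrier R"
  shows "scaling_maps R H #>\<^bsub>AGL1 R\<^esub> affine_map R h (h \<otimes> c) =
    scaling_maps R H #>\<^bsub>AGL1 R\<^esub> affine_map R \<one> c"
proof -
  have "affine_map R h \<zero> \<in> scaling_maps R H"
    using assms(1) by (simp add: scalings_eq)
  then show ?thesis
    unfolding affine_map_decomp[OF assms]
    by (rule group.rcoset_mult_absorb[OF group_AGL1 subgroup_scalings])
       (use assms affine_map_in_AGL1 in auto)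
qed

text \<open>After Parseval's identity the frequency \<open>u\<close> contributes \<open>FF u\<close>
  with weight \<open>N u\<close>, the number of \<open>h\<close> for which its character is trivial
  on \<open>h\<close> times \<open>G\<close>. Either this character is nontrivial on some product
  \<open>h \<otimes> g\<close>, and the weight is at most \<open>b\<close>, or it is trivial on
  \<open>V\<close>, and \<open>FF u\<close> vanishes because \<open>f\<close> has mean zero.\<close>

lemma coset_operator_bound:
  assumes \<psi>: "additive_character R \<psi>" "z \<in> carrier R" "\<psi> z \<noteq> 1"
    and b: "\<And>u. u \<in> carrier R \<Longrightarrow> \<exists>h\<in>H. \<exists>g\<in>G. \<psi> (u \<otimes> (h \<otimes> g)) \<noteq> 1 \<Longrightarrow>
      real (card {h\<in>H. \<forall>g\<in>G. \<psi> (u \<otimes> (h \<otimes> g)) = 1}) \<le> b"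
    and f: "l2_inner (rverts B) f (\<lambda>_. 1) = 0"
  shows "real (card H) * l2_norm (lverts B)
      (coset_operator (AGL1 R) (translation_maps R G) (scaling_maps R H) f) ^ 2 \<le>
    b * l2_norm (rverts B) f ^ 2"
proof -
  define F where "F c = (if c \<in> V then f (scaling_maps R H #>\<^bsub>AGL1 R\<^esub> affine_map R \<one> c) else 0)" for c
  define FF where "FF u = cmod (\<Sum>x\<in>carrier R. F x * \<psi> (u \<otimes> x)) ^ 2" for u
  define N where "N u = real (card {h\<in>H. \<forall>g\<in>G. \<psi> (u \<otimes> (h \<otimes> g)) = 1})" for u
  let ?q = "real (card (carrier R))"
  let ?g = "real (card G)"
  let ?Tf = "l2_norm (lverts B) (coset_operator (AGL1 R) (translation_maps R G) (scaling_maps R H) f)"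
  have pos: "?q > 0" "?g > 0" "card H > 0"
    using finite_carrier finite_H G_subset subringE(3)[OF G] one_in_H finite_subset
    by (auto simp: card_gt_0_iff)
  have FV: "F c = f (scaling_maps R H #>\<^bsub>AGL1 R\<^esub> affine_map R h (h \<otimes> c))" if "h \<in> H" "c \<in> V" for h c
    using that V_subset rcoset_scalings[of h c] by (auto simp: F_def)
  \<comment> \<open>Translating by \<open>g\<close> after scaling by \<open>h\<close> amounts to
    scaling by \<open>h\<close> after translating by \<open>inv h \<otimes> g\<close>; the shifted
    point stays in \<open>V\<close>, where \<open>F\<close> is given by \<open>f\<close>.\<close>
  have FV': "F (c \<oplus> inv h \<otimes> g) =
      f (scaling_maps R H #>\<^bsub>AGL1 R\<^esub> (affine_map R \<one> g \<otimes>\<^bsub>AGL1 R\<^esub> affine_map R h (h \<otimes> c)))"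
    if "h \<in> H" "c \<in> V" "g \<in> G" for h c g
  proof -
    have h: "h \<in> carrier R - {\<zero>}" and g: "g \<in> carrier R" and c: "c \<in> carrier R"
      using that H_subset G_subset V_subset by auto
    have "affine_map R \<one> g \<otimes>\<^bsub>AGL1 R\<^esub> affine_map R h (h \<otimes> c) =
        affine_map R h (h \<otimes> (c \<oplus> inv h \<otimes> g))"
      using h g c nonzero_inv[OF h] by (simp add: affine_map_mult r_distr m_assoc[symmetric])
    then show ?thesis
      using FV[OF that(1) V_translate[OF that(2,1,3)]] by simp
  qed
  have sumF: "(\<Sum>x\<in>carrier R. F x * w x) = (\<Sum>x\<in>V. F x * w x)" for w
    by (rule sum.mono_neutral_right) (use finite_carrier V_subset in \<open>auto simp: F_def\<close>)
  have mean: "(\<Sum>x\<in>V. F x) = 0"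
  proof -
    have "of_nat (card H) * (\<Sum>x\<in>V. F x) = (\<Sum>\<phi>\<in>carrier A. f (scaling_maps R H #>\<^bsub>AGL1 R\<^esub> \<phi>))"
      unfolding sum_A by (simp add: FV[symmetric])
    also have "\<dots> = 0"
      using l2_rverts(2)[OF group_AGL1 finite_A subgroup_scalings, of f] f by simp
    finally show ?thesis
      using pos by simp
  qed
  have norm: "(\<Sum>x\<in>carrier R. cmod (F x) ^ 2) = l2_norm (rverts B) f ^ 2"
  proof -
    have "real (card H) * (\<Sum>x\<in>V. cmod (F x) ^ 2) =
        (\<Sum>\<phi>\<in>carrier A. cmod (f (scaling_maps R H #>\<^bsub>AGL1 R\<^esub> \<phi>)) ^ 2)"
      unfolding sum_A by (simp add: FV[symmetric])
    also have "\<dots> = real (card H) * l2_norm (rverts B) f ^ 2"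
      using l2_rverts(1)[OF group_AGL1 finite_A subgroup_scalings, of f] by (simp add: card_scalings)
    finally have "(\<Sum>x\<in>V. cmod (F x) ^ 2) = l2_norm (rverts B) f ^ 2"
      using pos by simp
    moreover have "(\<Sum>x\<in>carrier R. cmod (F x) ^ 2) = (\<Sum>x\<in>V. cmod (F x) ^ 2)"
      by (rule sum.mono_neutral_right) (use finite_carrier V_subset in \<open>auto simp: F_def\<close>)
    ultimately show ?thesis
      by simp
  qed
  have le: "FF u * N u \<le> FF u * b" if u: "u \<in> carrier R" for u
  proof (cases "\<exists>h\<in>H. \<exists>g\<in>G. \<psi> (u \<otimes> (h \<otimes> g)) \<noteq> 1")
    case True
    then show ?thesis
      using b[OF u] by (intro mult_left_mono) (auto simp: N_def FF_def)
  next
    case False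
    then have "\<psi> (u \<otimes> x) = 1" if "x \<in> V" for x
      using character_trivial_on_V[OF additive_character_scale[OF \<psi>(1) u] _ that] by blast
    then have "FF u = 0"
      unfolding FF_def sumF using mean by simp
    then show ?thesis
      by simp
  qed
  have "?g ^ 2 * real (card H) * ?Tf ^ 2 = (\<Sum>h\<in>H. \<Sum>c\<in>V. cmod (\<Sum>g\<in>G. F (c \<oplus> inv h \<otimes> g)) ^ 2)"
    using l2_norm_coset_operator[OF group_AGL1 finite_A subgroup_translations subgroup_scalings, of f]
    by (simp add: card_translations card_scalings sum_translations sum_A FV')
  \<comment> \<open>Passing from \<open>V\<close> to the whole field only adds nonnegative
    terms.\<close>
  also have "\<dots> \<le> (\<Sum>h\<in>H. \<Sum>c\<in>carrier R. cmod (\<Sum>g\<in>G. F (c \<oplus> inv h \<otimes> g)) ^ 2)"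
    by (intro sum_mono sum_mono2) (use finite_carrier V_subset in auto)
  \<comment> \<open>Inversion permutes \<open>H\<close>, which removes \<open>inv\<close>.\<close>
  also have "\<dots> = (\<Sum>h\<in>H. \<Sum>c\<in>carrier R. cmod (\<Sum>g\<in>G. F (c \<oplus> h \<otimes> g)) ^ 2)"
  proof (rule sum.reindex_bij_betw)
    show "bij_betw (\<lambda>h. inv h) H H"
      by (rule bij_betw_byWitness[of _ "\<lambda>h. inv h"])
         (use inv_in_H H_subset field_Units in \<open>auto intro!: Units_inv_inv\<close>)
  qed
  finally have "?q * (?g ^ 2 * real (card H) * ?Tf ^ 2) \<le>
      (\<Sum>h\<in>H. ?q * (\<Sum>c\<in>carrier R. cmod (\<Sum>g\<in>G. F (c \<oplus> h \<otimes> g)) ^ 2))"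
    unfolding sum_distrib_left[symmetric] by (rule mult_left_mono) simp
  also have "\<dots> = (\<Sum>h\<in>H. \<Sum>u\<in>carrier R. FF u * (?g ^ 2 * of_bool (\<forall>g\<in>G. \<psi> (u \<otimes> (h \<otimes> g)) = 1)))"
    unfolding FF_def using H_subset
    by (intro sum.cong[OF refl] sum_translates[OF \<psi> finite_carrier G]) auto
  also have "\<dots> = (\<Sum>u\<in>carrier R. \<Sum>h\<in>H. FF u * (?g ^ 2 * of_bool (\<forall>g\<in>G. \<psi> (u \<otimes> (h \<otimes> g)) = 1)))"
    by (rule sum.swap)
  also have "\<dots> = (\<Sum>u\<in>carrier R. ?g ^ 2 * (FF u * N u))"
  proof (rule sum.cong[OF refl])
    fix u
    have "(\<Sum>h\<in>H. of_bool (\<forall>g\<in>G. \<psi> (u \<otimes> (h \<otimes> g)) = 1)) = N u"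
      using finite_H by (simp add: N_def of_bool_def sum.If_cases Int_def)
    then show "(\<Sum>h\<in>H. FF u * (?g ^ 2 * of_bool (\<forall>g\<in>G. \<psi> (u \<otimes> (h \<otimes> g)) = 1))) = ?g ^ 2 * (FF u * N u)"
      by (simp add: sum_distrib_left[symmetric])
  qed
  also have "\<dots> \<le> (\<Sum>u\<in>carrier R. ?g ^ 2 * (FF u * b))"
    by (intro sum_mono mult_left_mono le) auto
  also have "\<dots> = ?g ^ 2 * (b * (\<Sum>u\<in>carrier R. FF u))"
    by (simp add: sum_distrib_left[symmetric] sum_distrib_right[symmetric] mult.commute)
  also have "(\<Sum>u\<in>carrier R. FF u) = ?q * l2_norm (rverts B) f ^ 2"
    unfolding FF_def parseval[OF \<psi> finite_carrier order_refl] norm ..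
  finally have "(?q * ?g ^ 2) * (real (card H) * ?Tf ^ 2) \<le> (?q * ?g ^ 2) * (b * l2_norm (rverts B) f ^ 2)"
    by (simp add: ac_simps)
  then show ?thesis
    using pos by simp
qed

lemma sigma2_le:
  assumes \<psi>: "additive_character R \<psi>" "z \<in> carrier R" "\<psi> z \<noteq> 1"
    and b: "\<And>u. u \<in> carrier R \<Longrightarrow> \<exists>h\<in>H. \<exists>g\<in>G. \<psi> (u \<otimes> (h \<otimes> g)) \<noteq> 1 \<Longrightarrow>
      real (card {h\<in>H. \<forall>g\<in>G. \<psi> (u \<otimes> (h \<otimes> g)) = 1}) \<le> b"
  shows "sigma2 (AGL1 R) (translation_maps R G) (scaling_maps R H) \<le> sqrt (b / real (card H))"
  unfolding sigma2_def
proof (rule cSup_least)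
  \<comment> \<open>There must be a vector to test, since the supremum of the empty set is unspecified.\<close>
  let ?S = "scaling_maps R H"
  have HA: "subgroup ?S A"
    by (rule group.subgroup_of_subgroup_generated[OF group_AGL1 _ subgroup_scalings]) simp
  let ?R1 = "?S #>\<^bsub>A\<^esub> affine_map R \<one> \<zero>" and ?R2 = "?S #>\<^bsub>A\<^esub> affine_map R \<one> \<one>"
  have in_A: "affine_map R \<one> \<zero> \<in> carrier A" "affine_map R \<one> \<one> \<in> carrier A"
    using translation_in_A subringE(2,3)[OF G] by auto
  then have mem: "?R1 \<in> rverts B" "?R2 \<in> rverts B"
    unfolding coset_graph_simps
    by (simp_all add: group.rcosetsI[OF group_A subgroup.subset[OF HA]])
  have "finite (rverts B)"
    unfolding coset_graph_simps by (rule finite_UnionD)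
      (simp only: group.rcosets_part_G[OF group_A HA] finite_A)
  \<comment> \<open>\<open>?R1\<close> consists of the scalings, whose constant term is
    \<open>\<zero>\<close>, so the translation by \<open>\<one>\<close> lies in another
    coset.\<close>
  moreover have "?R1 \<noteq> ?R2"
  proof
    assume "?R1 = ?R2"
    then have "affine_map R \<one> \<one> \<in> ?R1"
      using group.rcos_self[OF group_A in_A(2) HA] by simp
    then obtain h where h: "h \<in> H" "affine_map R \<one> \<one> = affine_map R h \<zero> \<otimes>\<^bsub>AGL1 R\<^esub> affine_map R \<one> \<zero>"
      by (auto simp: r_coset_def scalings_eq)
    then have "affine_map R \<one> \<one> = affine_map R h \<zero>"
      using H_subset by (subst (asm) affine_map_mult) auto
    then show False
      using affine_map_eq_iff[of \<one> \<one> h \<zero>] h(1) H_subset by auto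
  qed
  ultimately obtain f where "l2_inner (rverts B) f (\<lambda>_. 1) = 0 \<and> l2_norm (rverts B) f = 1"
    using exists_l2_unit_vector_orthogonal_one[OF _ mem] by meson
  then show "{l2_norm (lverts B) (coset_operator (AGL1 R) (translation_maps R G) ?S f) | f.
      l2_inner (rverts B) f (\<lambda>_. 1) = 0 \<and> l2_norm (rverts B) f = 1} \<noteq> {}"
    by blast
next
  fix x
  assume "x \<in> {l2_norm (lverts B) (coset_operator (AGL1 R) (translation_maps R G) (scaling_maps R H) f) | f.
      l2_inner (rverts B) f (\<lambda>_. 1) = 0 \<and> l2_norm (rverts B) f = 1}"
  then obtain f where f: "l2_inner (rverts B) f (\<lambda>_. 1) = 0" "l2_norm (rverts B) f = 1"
    and x: "x = l2_norm (lverts B) (coset_operator (AGL1 R) (translation_maps R G) (scaling_maps R H) f)"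
    by (elim CollectE exE conjE)
  have "real (card H) * x ^ 2 \<le> b"
    using coset_operator_bound[OF \<psi> b f(1)] by (simp add: f(2) x)
  moreover have "card H > 0"
    using finite_H one_in_H by (auto simp: card_gt_0_iff)
  ultimately show "x \<le> sqrt (b / real (card H))"
    by (intro real_le_rsqrt) (simp add: field_simps)
qed

end

text \<open>If \<open>\<psi> (u \<otimes> (h \<otimes> g)) \<noteq> 1\<close> for some
  \<open>h\<close> and \<open>g\<close>, fix this \<open>g\<close>: any \<open>h\<close> whose
  multiples of \<open>G\<close> are all sent to \<open>1\<close> lies in the kernel of
  \<open>\<chi> x = \<psi> (u \<otimes> g \<otimes> x)\<close>. The kernel estimate is applied over
  \<open>K\<close> rather than over \<open>R\<close>, so that the error is the square root of
  \<open>card K\<close>.\<close>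

lemma (in field) sigma2_affine_le:
  assumes fin: "finite (carrier R)" and p: "Factorial_Ring.prime (ring_characteristic R)"
    and G: "subring G R" and K: "subfield K R"
    and H_K: "subgroup H (Multiplicative_Group.mult_of (R\<lparr>carrier := K\<rparr>))"
  shows "sigma2 (AGL1 R) (translation_maps R G) (scaling_maps R H) \<le>
    sqrt (1 / real (ring_characteristic R) + sqrt (real (card K)) / real (card H))"
proof -
  let ?p = "ring_characteristic R"
  interpret K: field "R\<lparr>carrier := K\<rparr>"
    by (rule subfield_iff(2)[OF K])
  interpret M: Group.group "Multiplicative_Group.mult_of R"
    by (rule field_mult_group)
  have KR: "K \<subseteq> carrier R"
    using subfieldE(3)[OF K] .
  have HK: "H \<subseteq> K - {\<zero>}"
    using subgroup.subset[OF H_K] by simp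
  have "subgroup (K - {\<zero>}) (Multiplicative_Group.mult_of R)"
    by (rule subgroup_mult_of[OF K])
  moreover have "subgroup H ((Multiplicative_Group.mult_of R)\<lparr>carrier := K - {\<zero>}\<rparr>)"
    using H_K by (simp add: Multiplicative_Group.mult_of_def)
  ultimately have HR: "subgroup H (Multiplicative_Group.mult_of R)"
    by (rule M.incl_subgroup)
  interpret affine_coset_graph R G H
    by (intro affine_coset_graph.intro affine_coset_graph_axioms.intro field_axioms fin G HR)
  obtain \<psi> z where \<psi>: "additive_character R \<psi>" "z \<in> carrier R" "\<psi> z \<noteq> 1"
    using exists_nontrivial_additive_character[OF fin one_not_zero p add_pow_ring_characteristic] by blast
  have "real (card {h \<in> H. \<forall>g\<in>G. \<psi> (u \<otimes> (h \<otimes> g)) = 1}) \<le>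
      real (card H) / real ?p + sqrt (real (card K))"
    if u: "u \<in> carrier R" and nontriv: "\<exists>h\<in>H. \<exists>g\<in>G. \<psi> (u \<otimes> (h \<otimes> g)) \<noteq> 1" for u
  proof -
    obtain h g where hg: "h \<in> H" "g \<in> G" "\<psi> (u \<otimes> (h \<otimes> g)) \<noteq> 1"
      using nontriv by blast
    have g: "g \<in> carrier R"
      using hg(2) G_subset by blast
    define \<chi> where "\<chi> x = \<psi> (u \<otimes> g \<otimes> x)" for x
    have \<chi>_eq: "\<chi> x = \<psi> (u \<otimes> (x \<otimes> g))" if "x \<in> H" for x
      using that u g H_subset by (simp add: \<chi>_def m_assoc m_comm[of x g] subset_eq)
    have \<chi>: "additive_character R \<chi>"
      unfolding \<chi>_def by (rule additive_character_scale[OF \<psi>(1)]) (use u g in simp)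
    have "real (card {h \<in> H. \<chi> h = 1}) \<le>
        real (card H) / real ?p + sqrt (real (card (carrier (R\<lparr>carrier := K\<rparr>))))"
    proof (rule K.card_additive_character_kernel_le)
      show "additive_character (R\<lparr>carrier := K\<rparr>) \<chi>"
        by (rule additive_character_subset[OF \<chi> KR])
      show "h \<in> carrier (R\<lparr>carrier := K\<rparr>)" "\<chi> h \<noteq> 1"
        using hg HK by (auto simp: \<chi>_eq)
      show "finite (carrier (R\<lparr>carrier := K\<rparr>))"
        using finite_subset[OF KR fin] by simp
      show "\<chi> x ^ ?p = 1" if "x \<in> carrier (R\<lparr>carrier := K\<rparr>)" for x
        using that KR by (intro additive_character_power_eq_1[OF \<chi>] add_pow_ring_characteristic) auto
    qed (use H_K p in auto)
    moreover have "card {h \<in> H. \<forall>g\<in>G. \<psi> (u \<otimes> (h \<otimes> g)) = 1} \<le> card {h \<in> H. \<chi> h = 1}"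
      using finite_H hg(2) by (intro card_mono) (auto simp: \<chi>_eq)
    ultimately show ?thesis
      by simp
  qed
  from sigma2_le[OF \<psi> this]
  have "sigma2 (AGL1 R) (translation_maps R G) (scaling_maps R H) \<le>
      sqrt ((real (card H) / real ?p + sqrt (real (card K))) / real (card H))" .
  moreover have "card H > 0"
    using finite_H one_in_H by (auto simp: card_gt_0_iff)
  then have "(real (card H) / real ?p + sqrt (real (card K))) / real (card H) =
      1 / real ?p + sqrt (real (card K)) / real (card H)"
    by (simp add: add_divide_distrib)
  ultimately show ?thesis
    by simp
qed

section \<open>Asymptotics as \<open>p\<close> grows\<close>

lemma tendsto_inverse_power_minus_one:
  "(\<lambda>p. 1 / (real p ^ Suc m - 1)) \<longlonglongrightarrow> 0"
proof (rule tendsto_divide_0[OF tendsto_const filterlim_at_top_imp_at_infinity])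
  show "filterlim (\<lambda>p. real p ^ Suc m - 1) at_top sequentially"
    using filterlim_tendsto_add_at_top[OF tendsto_const[of "-1"]
        filterlim_pow_at_top[OF _ filterlim_real_sequentially, of "Suc m"]] by simp
qed

theorem theorem5p8:
  fixes m :: nat and \<gamma> :: real
  assumes "m \<ge> 2" and "0 < \<gamma>" and "\<gamma> < 1" and "\<exists>k::nat. k > 0 \<and> \<gamma> = 1 / real k"
  shows "\<exists>\<epsilon> \<delta> :: nat \<Rightarrow> real. \<epsilon> \<longlonglongrightarrow> 0 \<and> \<delta> \<longlonglongrightarrow> 0 \<and>
    (\<forall>p::nat. Factorial_Ring.prime p \<and> \<gamma> * (real p - 1) \<in> \<int> \<longrightarrow>
      (\<forall>(F :: 'a ring) G K H.
         Ring.field F \<and> finite (carrier F) \<and> ring_characteristic F = p \<and>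
         subfield G F \<and> card G = p ^ m \<and>
         subfield K F \<and> card K = p ^ (m + 1) \<and>
         subgroup H (Multiplicative_Group.mult_of (F\<lparr>carrier := K\<rparr>)) \<and>
         cyclic_group ((Multiplicative_Group.mult_of F)\<lparr>carrier := H\<rparr>) \<and>
         real (card H) = \<gamma> * (real p ^ (m + 1) - 1) \<longrightarrow>
         sigma2 (AGL1 F) (translation_maps F G) (scaling_maps F H)
           \<le> sqrt (1 / real p + (1 + \<epsilon> p) / (\<gamma> * real p powr ((real m + 1) / 2)))) \<and>
      sqrt (1 / real p + (1 + \<epsilon> p) / (\<gamma> * real p powr ((real m + 1) / 2)))
        = (1 + \<delta> p) / sqrt (real p))"
proof -
  define s where "s = (real m + 1) / 2"
  \<comment> \<open>With \<open>q = p ^ (m + 1)\<close> this makes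
    \<open>1 + \<epsilon> p = q / (q - 1)\<close>, which accounts for the order of \<open>H\<close>
    being \<open>\<gamma> * (q - 1)\<close> instead of \<open>\<gamma> * q\<close>. It depends on
    \<open>p\<close> and \<open>m\<close> alone, so the bound is uniform in \<open>F\<close>,
    \<open>G\<close>, \<open>K\<close> and \<open>H\<close>.\<close>
  define \<epsilon> where "\<epsilon> p = 1 / (real p ^ (m + 1) - 1)" for p
  \<comment> \<open>Found by solving the final equation for \<open>\<delta> p\<close>; what remains
    to be shown is the limit.\<close>
  define \<delta> where "\<delta> p = sqrt (real p) * sqrt (1 / real p + (1 + \<epsilon> p) / (\<gamma> * real p powr s)) - 1" for p
  have \<epsilon>: "\<epsilon> \<longlonglongrightarrow> 0"
    using tendsto_inverse_power_minus_one[of m] by (simp add: \<epsilon>_def[abs_def])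
  \<comment> \<open>The exponent \<open>1 - s = (1 - m) / 2\<close> is negative.\<close>
  have "(\<lambda>p. real p powr (1 - s)) \<longlonglongrightarrow> 0"
    by (rule tendsto_neg_powr[OF _ filterlim_real_sequentially]) (use assms(1) in \<open>simp add: s_def\<close>)
  with \<epsilon> have "(\<lambda>p. sqrt (1 + (1 + \<epsilon> p) / \<gamma> * real p powr (1 - s)) - 1) \<longlonglongrightarrow> sqrt (1 + (1 + 0) / \<gamma> * 0) - 1"
    using assms(2) by (intro tendsto_intros) auto
  \<comment> \<open>The two expressions differ at \<open>p = 0\<close>, where
    \<open>\<delta> p\<close> is \<open>-1\<close> and the other one is \<open>0\<close>; they agree
    for positive \<open>p\<close>.\<close>
  moreover have "eventually (\<lambda>p. sqrt (1 + (1 + \<epsilon> p) / \<gamma> * real p powr (1 - s)) - 1 = \<delta> p) sequentially"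
    using eventually_gt_at_top[of 0]
  proof eventually_elim
    case (elim p)
    have "real p * (1 / real p + (1 + \<epsilon> p) / (\<gamma> * real p powr s)) =
        1 + (1 + \<epsilon> p) / \<gamma> * real p powr (1 - s)"
      using elim assms(2) by (simp add: powr_diff field_simps)
    then show ?case
      by (simp add: \<delta>_def flip: real_sqrt_mult)
  qed
  ultimately have \<delta>: "\<delta> \<longlonglongrightarrow> 0"
    using Lim_transform_eventually by fastforce
  have bound: "sigma2 (AGL1 F) (translation_maps F G) (scaling_maps F H) \<le>
      sqrt (1 / real p + (1 + \<epsilon> p) / (\<gamma> * real p powr s))"
    if p: "Factorial_Ring.prime p" and F: "Ring.field F" "finite (carrier F)" "ring_characteristic F = p"
      and G: "subfield G F" and K: "subfield K F" "card K = p ^ (m + 1)"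
      and H: "subgroup H (Multiplicative_Group.mult_of (F\<lparr>carrier := K\<rparr>))"
        "real (card H) = \<gamma> * (real p ^ (m + 1) - 1)"
    for p and F :: "'a ring" and G K H
  proof -
    define q where "q = real p ^ (m + 1)"
    have p1: "real p > 1"
      using p prime_gt_1_nat by simp
    then have q: "q > 1"
      unfolding q_def by (intro one_less_power) auto
    have "real p powr s = sqrt (real p powr (real m + 1))"
      using p1 by (simp add: s_def powr_half_sqrt[symmetric] powr_powr)
    also have "real p powr (real m + 1) = q"
      using p1 powr_realpow[of "real p" "m + 1"] by (simp add: q_def add.commute)
    finally have s: "real p powr s = sqrt q" .
    have "1 + \<epsilon> p = q / (q - 1)"
      using q by (simp only: \<epsilon>_def flip: q_def) (simp add: field_simps)
    then have "(1 + \<epsilon> p) / (\<gamma> * real p powr s) = q / (q - 1) / (\<gamma> * sqrt q)"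
      by (simp only: s)
    also have "\<dots> = sqrt q / (\<gamma> * (q - 1))"
      using q assms(2) real_sqrt_mult_self[of q] by (simp add: field_simps)
    finally have "(1 + \<epsilon> p) / (\<gamma> * real p powr s) = sqrt (real (card K)) / real (card H)"
      using K(2) H(2) by (simp add: q_def)
    moreover have "subring G F"
      using subfieldE(1)[OF G] .
    ultimately show ?thesis
      using field.sigma2_affine_le[OF F(1,2) _ _ K(1) H(1), of G] p F(3) by simp
  qed
  have "sqrt (1 / real p + (1 + \<epsilon> p) / (\<gamma> * real p powr s)) = (1 + \<delta> p) / sqrt (real p)"
    if "Factorial_Ring.prime p" for p
    using prime_gt_0_nat[OF that] by (simp add: \<delta>_def)
  then show ?thesis
    using \<epsilon> \<delta> bound by (intro exI[of _ \<epsilon>] exI[of _ \<delta>]) (auto simp: s_def)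
qed

end
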